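(* Let $(X,d)$ and $(Y,d)$ be metric spaces, let $E,F$ be strictly convex normed spaces over $\mathbb{K}$, and let $T:\mathrm{Lip}(X,E)\to\mathrm{Lip}(Y,F)$ be a surjective linear isometry satisfying Property P. Then $E$ and $F$ are linearly isometric. Furthermore, if either (1) $X$ and $Y$ are complete, or (2) $E$ (or $F$) is not complete, then $T$ is standard.
   Context: $\mathbb{K}=\mathbb{R}$ or $\mathbb{C}$. A normed space is strictly convex if $\|e_1+e_2\|<2$ whenever $e_1\neq e_2$ both have norm $1$. For a metric space $X$, $\mathrm{Lip}(X,E)$ is the space of bounded Lipschitz maps $f:X\to E$, with Lipschitz number $L(f)=\sup_{x\neq y}\|f(x)-f(y)\|/d(x,y)$, normed by $\|f\|_L=\max\{\|f\|_\infty,L(f)\}$; isometries are with respect to this norm. For $e\in E$, $\tilde e$ denotes the constant function with value $e$. $T$ satisfies Property P if for every $y\in Y$ there is $e\in E$ with $(T\tilde e)(y)\neq 0$. For $R>0$, $x\sim_R y$ if there are $x=x_1,\dots,x_n=y$ in the space with $d(x_i,x_{i+1})<R$; the equivalence classes are the $R$-components. $\mathrm{Iso}(Y,X)$ is the set of bijections $h:Y\to X$ such that $d(h(y),h(y'))=d(y,y')$ whenever $d(y,y')<2$ and $d(h^{-1}(x),h^{-1}(x'))=d(x,x')$ whenever $d(x,x')<2$. $I(E,F)$ is the set of surjective linear isometries $E\to F$. $T$ is standard if there exist $h\in\mathrm{Iso}(Y,X)$ and a map $J:Y\to I(E,F)$, constant on each $2$-component of $Y$, with $Tf(y)=Jy(f(h(y)))$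 for all $f\in\mathrm{Lip}(X,E)$, $y\in Y$. *)

theory Defs
  imports "HOL-Analysis.Analysis"
begin

text \<open>Scalar field K: either the reals (K = \<real>, viewed inside the complex numbers)
  or the complex numbers (K = UNIV). A normed space over K is a real normed vector
  space together with a scalar multiplication by elements of K that extends the
  real scalar multiplication and is compatible with the norm.\<close>

definition scalar_field :: "complex set \<Rightarrow> bool" where
  "scalar_field K \<longleftrightarrow> K = \<real> \<or> K = UNIV"

definition normed_space_over ::
  "complex set \<Rightarrow> (complex \<Rightarrow> 'e::real_normed_vector \<Rightarrow> 'e) \<Rightarrow> bool" where
  "normed_space_over K sc \<longleftrightarrow>
     (\<forall>r x. sc (complex_of_real r) x = r *\<^sub>R x) \<and>
     (\<forall>c\<in>K. \<forall>d\<in>K. \<forall>x y.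
        sc c (x + y) = sc c x + sc c y \<and>
        sc (c + d) x = sc c x + sc d x \<and>
        sc (c * d) x = sc c (sc d x) \<and>
        norm (sc c x) = cmod c * norm x)"

definition K_linear ::
  "complex set \<Rightarrow> (complex \<Rightarrow> 'a \<Rightarrow> 'a) \<Rightarrow> (complex \<Rightarrow> 'b \<Rightarrow> 'b)
     \<Rightarrow> ('a::ab_group_add \<Rightarrow> 'b::ab_group_add) \<Rightarrow> bool" where
  "K_linear K scA scB S \<longleftrightarrow>
     (\<forall>x y. S (x + y) = S x + S y) \<and> (\<forall>c\<in>K. \<forall>x. S (scA c x) = scB c (S x))"

definition lin_isos ::
  "complex set \<Rightarrow> (complex \<Rightarrow> 'e \<Rightarrow> 'e) \<Rightarrow> (complex \<Rightarrow> 'f \<Rightarrow> 'f)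
     \<Rightarrow> ('e::real_normed_vector \<Rightarrow> 'f::real_normed_vector) set" where
  "lin_isos K scE scF =
     {S. surj S \<and> K_linear K scE scF S \<and> (\<forall>x. norm (S x) = norm x)}"

definition strictly_convex :: "'e::real_normed_vector itself \<Rightarrow> bool" where
  "strictly_convex _ \<longleftrightarrow>
     (\<forall>e1 e2::'e. norm e1 = 1 \<and> norm e2 = 1 \<and> e1 \<noteq> e2 \<longrightarrow> norm (e1 + e2) < 2)"

definition Lip :: "('x::metric_space \<Rightarrow> 'e::real_normed_vector) set" where
  "Lip = {f. bounded (range f) \<and> (\<exists>C. C-lipschitz_on UNIV f)}"

definition lip_number :: "('x::metric_space \<Rightarrow> 'e::real_normed_vector) \<Rightarrow> real" where
  "lip_number f = Sup ({0} \<union> {dist (f x) (f y) / dist x y | x y. x \<noteq> y})"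

definition sup_norm :: "('x \<Rightarrow> 'e::real_normed_vector) \<Rightarrow> real" where
  "sup_norm f = Sup (range (\<lambda>x. norm (f x)))"

definition lip_norm :: "('x::metric_space \<Rightarrow> 'e::real_normed_vector) \<Rightarrow> real" where
  "lip_norm f = max (sup_norm f) (lip_number f)"

definition property_P ::
  "(('x \<Rightarrow> 'e) \<Rightarrow> ('y \<Rightarrow> 'f::zero)) \<Rightarrow> bool" where
  "property_P T \<longleftrightarrow> (\<forall>y. \<exists>e. T (\<lambda>_. e) y \<noteq> 0)"

definition R_related :: "real \<Rightarrow> 'a::metric_space \<Rightarrow> 'a \<Rightarrow> bool" where
  "R_related R = (\<lambda>a b. dist a b < R)\<^sup>*\<^sup>*"

definition Iso2 :: "('y::metric_space \<Rightarrow> 'x::metric_space) set" where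
  "Iso2 = {h. bij h \<and>
     (\<forall>y y'. dist y y' < 2 \<longrightarrow> dist (h y) (h y') = dist y y') \<and>
     (\<forall>x x'. dist x x' < 2 \<longrightarrow> dist (inv h x) (inv h x') = dist x x')}"

definition standard ::
  "complex set \<Rightarrow> (complex \<Rightarrow> 'e \<Rightarrow> 'e) \<Rightarrow> (complex \<Rightarrow> 'f \<Rightarrow> 'f)
    \<Rightarrow> (('x::metric_space \<Rightarrow> 'e::real_normed_vector) \<Rightarrow> ('y::metric_space \<Rightarrow> 'f::real_normed_vector))
    \<Rightarrow> bool" where
  "standard K scE scF T \<longleftrightarrow>
     (\<exists>(h::'y \<Rightarrow> 'x) (J::'y \<Rightarrow> 'e \<Rightarrow> 'f).
        h \<in> Iso2 \<and> (\<forall>y. J y \<in> lin_isos K scE scF) \<and>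
        (\<forall>y y'. R_related 2 y y' \<longrightarrow> J y = J y') \<and>
        (\<forall>f\<in>Lip. \<forall>y. T f y = J y (f (h y))))"

end

theory Submission
  imports Defs
begin

text \<open>
  Write \<open>S\<close> for the inverse of \<open>T\<close>. For \<open>y\<close> in \<open>Y\<close> and a unit vector \<open>v\<close>, let \<open>p\<close> be the tent function
  of slope \<open>1/2\<close> with peak \<open>v\<close> at \<open>y\<close>. By Property P and strict convexity a small constant \<open>e\<close> can be
  added to \<open>S p\<close> such that \<open>\<phi> = S p + e\<close> has norm \<open>N > 1\<close>, while its Lipschitz number is at most
  \<open>1\<close>; its image \<open>T \<phi>\<close> still peaks only at \<open>y\<close>. If \<open>\<psi>\<close> can be subtracted from \<open>\<phi>\<close> without
  increasing the norm and vanishes at points where \<open>\<phi>\<close> nearly attains its norm, then \<open>\<phi>\<close> and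
  \<open>\<phi> - \<psi>\<close> have a sum of norm \<open>2 N\<close>, hence so do their images at \<open>y\<close>, and strict convexity at the
  single point \<open>y\<close> gives \<open>T \<psi> y = 0\<close>. Consequently the sets where \<open>\<phi>\<close> nearly attains its norm
  cannot be separated by a Lipschitz function, so they shrink to a Cauchy sequence \<open>x\<^sub>n\<close>, and \<open>T f y\<close>
  depends only on \<open>f\<close> near this sequence. The same perturbation argument shows that \<open>T\<close> does not
  increase the sup norm, whence \<open>\<parallel>T f y\<parallel> \<le> lim \<parallel>f x\<^sub>n\<parallel>\<close>; equality follows from the
  corresponding bound for \<open>S\<close>.

  If \<open>x\<^sub>n\<close> does not converge in \<open>X\<close>, every Cauchy sequence in \<open>E\<close> is asymptotic to \<open>f x\<^sub>n\<close> for
  some \<open>f\<close> in \<open>Lip\<close>, which forces \<open>F\<close>, and then \<open>E\<close>, to be complete. The metric statements follow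
  by comparing the least norms of Lipschitz functions with two prescribed values.
\<close>

section \<open>Bounded Lipschitz functions\<close>

text \<open>The closed ball of radius \<open>C\<close> for \<open>lip_norm\<close>, written without
  suprema. The isometry of \<open>T\<close> is used only in the form that \<open>T\<close> preserves
  membership in each of these balls.\<close>

definition lip_ball :: "real \<Rightarrow> ('x::metric_space \<Rightarrow> 'e::real_normed_vector) set" where
  "lip_ball C = {f. (\<forall>x. norm (f x) \<le> C) \<and> (\<forall>x y. norm (f x - f y) \<le> C * dist x y)}"

lemma lip_ballI:
  assumes "\<And>x. norm (f x) \<le> C" "\<And>x y. norm (f x - f y) \<le> C * dist x y"
  shows "f \<in> lip_ball C"
  using assms by (simp add: lip_ball_def)

lemma lip_ball_norm: "f \<in> lip_ball C \<Longrightarrow> norm (f x) \<le> C"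
  by (simp add: lip_ball_def)

lemma lip_ball_diff: "f \<in> lip_ball C \<Longrightarrow> norm (f x - f y) \<le> C * dist x y"
  by (simp add: lip_ball_def)

lemma lip_ball_nonneg: "f \<in> lip_ball C \<Longrightarrow> 0 \<le> C"
  by (meson lip_ball_norm norm_ge_zero order_trans)

lemma lip_ball_Lip: "f \<in> lip_ball C \<Longrightarrow> f \<in> Lip"
  using lip_ball_nonneg[of f C]
  by (auto simp: lip_ball_def Lip_def bounded_iff lipschitz_on_def dist_norm)

lemma Lip_lip_ball:
  assumes "f \<in> Lip"
  obtains C where "0 < C" "f \<in> lip_ball C"
proof -
  obtain B where B: "\<And>x. norm (f x) \<le> B"
    using assms by (auto simp: Lip_def bounded_iff)
  obtain L where L: "L-lipschitz_on UNIV f"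
    using assms by (auto simp: Lip_def)
  have "f \<in> lip_ball (max 1 (max B L))"
  proof (rule lip_ballI)
    fix x y
    show "norm (f x) \<le> max 1 (max B L)" using B[of x] by simp
    have "norm (f x - f y) \<le> L * dist x y"
      using L by (simp add: lipschitz_on_def dist_norm)
    also have "\<dots> \<le> max 1 (max B L) * dist x y"
      by (intro mult_right_mono) auto
    finally show "norm (f x - f y) \<le> max 1 (max B L) * dist x y" .
  qed
  moreover have "0 < max 1 (max B L)" by simp
  ultimately show thesis using that by blast
qed

lemma lip_ball_const: "norm e \<le> C \<Longrightarrow> (\<lambda>_. e) \<in> lip_ball C"
  by (rule lip_ballI) (auto intro: mult_nonneg_nonneg order_trans[OF norm_ge_zero])

lemma lip_ball_add:
  assumes "f \<in> lip_ball C" "g \<in> lip_ball D"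
  shows "(\<lambda>x. f x + g x) \<in> lip_ball (C + D)"
proof (rule lip_ballI)
  fix x y
  show "norm (f x + g x) \<le> C + D"
    by (intro norm_triangle_mono lip_ball_norm assms)
  have "norm ((f x - f y) + (g x - g y)) \<le> C * dist x y + D * dist x y"
    by (intro norm_triangle_mono lip_ball_diff assms)
  then show "norm (f x + g x - (f y + g y)) \<le> (C + D) * dist x y"
    by (simp add: algebra_simps)
qed

lemma lip_ball_mult:
  fixes b :: "'x::metric_space \<Rightarrow> real"
  assumes "f \<in> lip_ball C" "\<And>x. \<bar>b x\<bar> \<le> M" "B-lipschitz_on UNIV b"
  shows "(\<lambda>x. b x *\<^sub>R f x) \<in> lip_ball (M * C + B * C)"
proof (rule lip_ballI)
  fix x y
  have M: "0 \<le> M" using assms(2)[of x] by linarith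
  have B: "0 \<le> B" using assms(3) by (simp add: lipschitz_on_def)
  note C = lip_ball_nonneg[OF assms(1)]
  have "norm (b x *\<^sub>R f x) \<le> M * C"
    using assms(2)[of x] lip_ball_norm[OF assms(1), of x] M by (simp add: mult_mono)
  also have "\<dots> \<le> M * C + B * C" using B C by simp
  finally show "norm (b x *\<^sub>R f x) \<le> M * C + B * C" .
  have eq: "b x *\<^sub>R f x - b y *\<^sub>R f y = b x *\<^sub>R (f x - f y) + (b x - b y) *\<^sub>R f y"
    by (simp add: algebra_simps)
  have 1: "norm (b x *\<^sub>R (f x - f y)) \<le> M * (C * dist x y)"
    using assms(2)[of x] lip_ball_diff[OF assms(1), of x y] M by (simp add: mult_mono)
  have "\<bar>b x - b y\<bar> \<le> B * dist x y"
    using assms(3) by (simp add: lipschitz_on_def dist_real_def)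
  then have 2: "norm ((b x - b y) *\<^sub>R f y) \<le> (B * dist x y) * C"
    using lip_ball_norm[OF assms(1), of y] B by (simp add: mult_mono)
  show "norm (b x *\<^sub>R f x - b y *\<^sub>R f y) \<le> (M * C + B * C) * dist x y"
    unfolding eq using norm_triangle_mono[OF 1 2] by (simp add: algebra_simps)
qed

lemma Lip_const: "(\<lambda>_. e) \<in> Lip"
  by (rule lip_ball_Lip[OF lip_ball_const[OF order_refl]])

lemma Lip_add: "f \<in> Lip \<Longrightarrow> g \<in> Lip \<Longrightarrow> (\<lambda>x. f x + g x) \<in> Lip"
  by (elim Lip_lip_ball) (rule lip_ball_Lip, rule lip_ball_add)

lemma Lip_mult:
  fixes b :: "'x::metric_space \<Rightarrow> real"
  assumes "f \<in> Lip" "\<And>x. \<bar>b x\<bar> \<le> M" "B-lipschitz_on UNIV b"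
  shows "(\<lambda>x. b x *\<^sub>R f x) \<in> Lip"
  using assms(1) by (elim Lip_lip_ball) (rule lip_ball_Lip, rule lip_ball_mult[OF _ assms(2,3)])

lemma Lip_scale: "f \<in> Lip \<Longrightarrow> (\<lambda>x. c *\<^sub>R f x) \<in> Lip"
  by (rule Lip_mult[where b = "\<lambda>_. c" and M = "\<bar>c\<bar>" and B = 0]) (auto simp: lipschitz_on_def)

lemma Lip_diff: "f \<in> Lip \<Longrightarrow> g \<in> Lip \<Longrightarrow> (\<lambda>x. f x - g x) \<in> Lip"
  using Lip_add[of f "\<lambda>x. (-1) *\<^sub>R g x"] Lip_scale[of g "-1"] by simp

lemma Lip_Cauchy:
  assumes "f \<in> Lip" "Cauchy x" shows "Cauchy (\<lambda>n. f (x n))"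
proof (rule metric_CauchyI)
  fix e :: real assume e: "0 < e"
  obtain L where L: "0 < L" "f \<in> lip_ball L" using Lip_lip_ball[OF assms(1)] .
  obtain M where M: "\<And>m n. M \<le> m \<Longrightarrow> M \<le> n \<Longrightarrow> dist (x m) (x n) < e / L"
    using metric_CauchyD[OF assms(2), of "e / L"] e L by auto
  have "dist (f (x m)) (f (x n)) < e" if "M \<le> m" "M \<le> n" for m n
    using lip_ball_diff[OF L(2), of "x m" "x n"] M[OF that] L
    by (auto simp: dist_norm field_simps intro: order_le_less_trans)
  then show "\<exists>M. \<forall>m\<ge>M. \<forall>n\<ge>M. dist (f (x m)) (f (x n)) < e" by blast
qed

text \<open>Both suprema are taken over nonempty sets that are bounded above. The extra element 0 in
  \<open>lip_number\<close> adds only the demand \<open>0 \<le> C\<close>, which the bound on values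
  already implies.\<close>

lemma lip_norm_le_iff:
  assumes "f \<in> Lip"
  shows "lip_norm f \<le> C \<longleftrightarrow> f \<in> lip_ball C"
proof -
  obtain D where D: "0 < D" "f \<in> lip_ball D" using Lip_lip_ball[OF assms] .
  have bs: "bdd_above (range (\<lambda>x. norm (f x)))"
    using D lip_ball_norm by (intro bdd_aboveI2) blast
  have bl: "bdd_above ({0} \<union> {dist (f x) (f y) / dist x y | x y. x \<noteq> y})"
    using D lip_ball_diff[OF D(2)]
    by (intro bdd_aboveI[where M = D]) (auto simp: dist_norm divide_le_eq)
  have "sup_norm f \<le> C \<longleftrightarrow> (\<forall>x. norm (f x) \<le> C)"
    unfolding sup_norm_def using cSup_le_iff[OF _ bs] by auto
  moreover have "lip_number f \<le> C \<longleftrightarrow> 0 \<le> C \<and> (\<forall>x y. x \<noteq> y \<longrightarrow> dist (f x) (f y) / dist x y \<le> C)"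
    unfolding lip_number_def using cSup_le_iff[OF _ bl] by auto
  moreover have "(\<forall>x y. x \<noteq> y \<longrightarrow> dist (f x) (f y) / dist x y \<le> C) \<longleftrightarrow>
      (\<forall>x y. norm (f x - f y) \<le> C * dist x y)"
    by (metis diff_self dist_eq_0_iff dist_norm mult_zero_right norm_zero order_refl
        pos_divide_le_eq zero_less_dist_iff)
  ultimately show ?thesis
    unfolding lip_norm_def lip_ball_def
    by (auto intro: order_trans[OF norm_ge_zero])
qed

section \<open>Tents and cutoffs\<close>

definition tent :: "'x::metric_space \<Rightarrow> real \<Rightarrow> 'x \<Rightarrow> real" where
  "tent a \<delta> x = max 0 (\<delta> - dist x a)"

lemma tent_lipschitz: "1-lipschitz_on UNIV (tent a \<delta>)"
proof (rule lipschitz_onI)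
  fix x y
  show "dist (tent a \<delta> x) (tent a \<delta> y) \<le> 1 * dist x y"
    unfolding tent_def dist_real_def using dist_triangle[of x a y] dist_triangle[of y a x]
    by (auto simp: dist_commute max_def abs_if)
qed simp

lemma tent_bounds: "0 < \<delta> \<Longrightarrow> 0 \<le> tent a \<delta> x" "0 < \<delta> \<Longrightarrow> tent a \<delta> x \<le> \<delta>"
  by (auto simp: tent_def)

lemma tent_Lip:
  assumes "0 < \<delta>" shows "(\<lambda>x. tent a \<delta> x *\<^sub>R v) \<in> Lip"
  by (rule Lip_mult[OF Lip_const _ tent_lipschitz, where M = \<delta>])
     (use assms in \<open>auto simp: tent_def\<close>)

definition cutoff :: "'x::metric_space \<Rightarrow> real \<Rightarrow> 'x \<Rightarrow> real" where
  "cutoff a \<rho> x = min 1 (tent a (2 * \<rho>) x / \<rho>)"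

lemma cutoff_props:
  assumes "0 < \<rho>"
  shows "0 \<le> cutoff a \<rho> x" "cutoff a \<rho> x \<le> 1"
    "dist x a \<le> \<rho> \<Longrightarrow> cutoff a \<rho> x = 1" "2 * \<rho> \<le> dist x a \<Longrightarrow> cutoff a \<rho> x = 0"
  using assms by (auto simp: cutoff_def tent_def min_def max_def field_simps)

lemma cutoff_abs_le: "0 < \<rho> \<Longrightarrow> \<bar>cutoff a \<rho> x\<bar> \<le> 1"
  using cutoff_props(1,2)[of \<rho> a x] by simp

lemma cutoff_lipschitz:
  assumes "0 < \<rho>"
  shows "(1 / \<rho>)-lipschitz_on UNIV (cutoff a \<rho>)"
proof (rule lipschitz_onI)
  fix x y
  have "\<bar>tent a (2 * \<rho>) x - tent a (2 * \<rho>) y\<bar> \<le> dist x y"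
    using lipschitz_onD[OF tent_lipschitz, of x y a "2 * \<rho>"] by (simp add: dist_real_def)
  then have "\<bar>tent a (2 * \<rho>) x / \<rho> - tent a (2 * \<rho>) y / \<rho>\<bar> \<le> dist x y / \<rho>"
    using assms by (simp add: abs_divide divide_right_mono flip: diff_divide_distrib)
  moreover have "\<bar>min 1 s - min 1 t\<bar> \<le> \<bar>s - t\<bar>" for s t :: real by linarith
  ultimately show "dist (cutoff a \<rho> x) (cutoff a \<rho> y) \<le> 1 / \<rho> * dist x y"
    unfolding cutoff_def dist_real_def by (auto intro: order_trans)
qed (use assms in simp)

section \<open>Strict convexity and interpolation between two values\<close>

text \<open>The triangle inequality forces both norms to equal \<open>N\<close>; dividing by
  \<open>N\<close> then leads back to the unit sphere.\<close>

lemma strictly_convex_eq: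
  fixes a b :: "'e::real_normed_vector"
  assumes "strictly_convex TYPE('e)" "norm a \<le> N" "norm b \<le> N" "2 * N \<le> norm (a + b)"
  shows "a = b"
proof (rule ccontr)
  assume ne: "a \<noteq> b"
  have "norm (a + b) \<le> norm a + norm b" by (rule norm_triangle_ineq)
  then have N: "norm a = N" "norm b = N" using assms by auto
  have "N \<noteq> 0" using ne N by auto
  then have pos: "0 < N" using N norm_ge_zero[of a] by linarith
  have "norm ((1/N) *\<^sub>R a + (1/N) *\<^sub>R b) < 2"
    using assms(1) N pos ne unfolding strictly_convex_def by simp
  moreover have "(1/N) *\<^sub>R a + (1/N) *\<^sub>R b = (1/N) *\<^sub>R (a + b)"
    by (rule scaleR_add_right[symmetric])
  ultimately have "norm (a + b) < 2 * N"
    using pos by (simp add: divide_less_eq)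
  then show False using assms(4) by simp
qed

text \<open>A tent of radius \<open>dist x x'\<close> at \<open>x\<close> moves the value along the
  segment from \<open>w\<close> to \<open>u\<close>, so it stays in the unit ball. If
  \<open>u\<close> or \<open>w\<close> is a unit vector, no function with these two values has a
  smaller norm.\<close>

lemma segment_extension:
  fixes x x' :: "'x::metric_space" and u w :: "'e::real_normed_vector"
  assumes "x \<noteq> x'" "norm u \<le> 1" "norm w \<le> 1"
  shows "\<exists>f\<in>lip_ball (max 1 (norm (u - w) / dist x x')). f x = u \<and> f x' = w"
proof -
  define D where "D = dist x x'"
  have D: "0 < D" using assms by (simp add: D_def)
  define \<theta> where "\<theta> = (\<lambda>z. tent x D z / D)"
  have \<theta>: "0 \<le> \<theta> z" "\<theta> z \<le> 1" for z
    using D tent_bounds[OF D, of x z] by (auto simp: \<theta>_def)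
  define f where "f = (\<lambda>z. (1 - \<theta> z) *\<^sub>R w + \<theta> z *\<^sub>R u)"
  have "f \<in> lip_ball (max 1 (norm (u - w) / D))"
  proof (rule lip_ballI)
    fix z z'
    have "norm (f z) \<le> (1 - \<theta> z) * 1 + \<theta> z * 1"
      unfolding f_def using \<theta>[of z] assms
      by (intro norm_triangle_mono) (auto intro!: mult_left_le)
    then show "norm (f z) \<le> max 1 (norm (u - w) / D)" by simp
    have "f z - f z' = (\<theta> z - \<theta> z') *\<^sub>R (u - w)" by (simp add: f_def algebra_simps)
    moreover have "\<bar>\<theta> z - \<theta> z'\<bar> \<le> dist z z' / D"
      using lipschitz_onD[OF tent_lipschitz, of z z' x D] D
      by (simp add: \<theta>_def dist_real_def abs_divide divide_right_mono flip: diff_divide_distrib)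
    ultimately have "norm (f z - f z') \<le> dist z z' / D * norm (u - w)"
      by (simp only: norm_scaleR, intro mult_right_mono) auto
    also have "\<dots> = norm (u - w) / D * dist z z'" by simp
    also have "\<dots> \<le> max 1 (norm (u - w) / D) * dist z z'" by (intro mult_right_mono) auto
    finally show "norm (f z - f z') \<le> max 1 (norm (u - w) / D) * dist z z'" .
  qed
  moreover have "f x = u" "f x' = w"
    using D by (auto simp: f_def \<theta>_def tent_def D_def dist_commute)
  ultimately show ?thesis unfolding D_def by blast
qed

section \<open>Lipschitz functions along a divergent Cauchy sequence\<close>

lemma sum_half_powers_le: "(\<Sum>k\<in>{m..<n}. (1 / 2 :: real) ^ k) \<le> 2 * (1 / 2) ^ m"
proof (cases "m \<le> n")
  case True
  then have "(\<Sum>k\<in>{m..<n}. (1 / 2 :: real) ^ k) = 2 * (1 / 2) ^ m - 2 * (1 / 2) ^ n"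
    by (induction rule: dec_induct) auto
  then show ?thesis by simp
qed simp

text \<open>The function is an infinite staircase in the distance to the missing limit point of \<open>x\<close>.
  Near every point of the space only finitely many steps are present, so that no
  completeness of the range is needed to define it.\<close>

lemma Lip_along_divergent_Cauchy:
  fixes x :: "nat \<Rightarrow> 'x::metric_space" and u :: "nat \<Rightarrow> 'e::real_normed_vector"
  assumes x: "Cauchy x" "\<not> convergent x" and u: "Cauchy u"
  shows "\<exists>f\<in>Lip. (\<lambda>n. f (x n) - u n) \<longlonglongrightarrow> 0"
proof -
  \<comment> \<open>\<open>D z\<close> is the distance from \<open>z\<close> to the limit of
    \<open>x\<close> in the completion; it is positive because that limit is missing.\<close>
  define D where "D = (\<lambda>z. lim (\<lambda>n. dist z (x n)))"
  have D: "(\<lambda>n. dist z (x n)) \<longlonglongrightarrow> D z" for z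
  proof -
    have "Cauchy (\<lambda>n. dist z (x n))"
    proof (rule metric_CauchyI)
      fix e :: real assume "0 < e"
      then obtain M where "\<And>m n. M \<le> m \<Longrightarrow> M \<le> n \<Longrightarrow> dist (x m) (x n) < e"
        using metric_CauchyD[OF x(1)] by blast
      moreover have "dist (dist z (x m)) (dist z (x n)) \<le> dist (x m) (x n)" for m n
        using dist_triangle[of z "x m" "x n"] dist_triangle[of z "x n" "x m"]
        by (simp add: dist_real_def dist_commute)
      ultimately show "\<exists>M. \<forall>m\<ge>M. \<forall>n\<ge>M. dist (dist z (x m)) (dist z (x n)) < e"
        by (meson order_le_less_trans)
    qed
    then show ?thesis
      unfolding D_def by (intro convergent_LIMSEQ_iff[THEN iffD1] Cauchy_convergent)
  qed
  have D_lip: "\<bar>D z - D z'\<bar> \<le> dist z z'" for z z'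
  proof (rule LIMSEQ_le_const2)
    show "(\<lambda>n. \<bar>dist z (x n) - dist z' (x n)\<bar>) \<longlonglongrightarrow> \<bar>D z - D z'\<bar>"
      by (intro tendsto_intros D)
    have "\<bar>dist z (x n) - dist z' (x n)\<bar> \<le> dist z z'" for n
      using dist_triangle[of z "x n" z'] dist_triangle[of z' "x n" z] by (simp add: dist_commute)
    then show "\<exists>N. \<forall>n\<ge>N. \<bar>dist z (x n) - dist z' (x n)\<bar> \<le> dist z z'" by blast
  qed
  have D_pos: "0 < D z" for z
  proof -
    have "0 \<le> D z" by (rule LIMSEQ_le_const[OF D]) auto
    moreover have "D z \<noteq> 0"
    proof
      assume "D z = 0"
      then have "x \<longlonglongrightarrow> z" using D[of z] tendsto_dist_iff[of x z sequentially] by (simp add: dist_commute)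
      then show False using x(2) by (auto simp: convergent_def)
    qed
    ultimately show ?thesis by simp
  qed
  have D_x: "\<exists>M. \<forall>n\<ge>M. D (x n) \<le> e" if e: "0 < e" for e
  proof -
    obtain M where M: "\<And>m n. M \<le> m \<Longrightarrow> M \<le> n \<Longrightarrow> dist (x m) (x n) < e"
      using metric_CauchyD[OF x(1) e] by blast
    have "D (x m) \<le> e" if "M \<le> m" for m
      by (rule LIMSEQ_le_const2[OF D]) (use M[OF that] in \<open>auto intro: less_imp_le\<close>)
    then show ?thesis by blast
  qed
  \<comment> \<open>The rate \<open>1 / 4\<close> beats the slopes \<open>2 ^ k\<close> of the steps
    below, so that the Lipschitz constants still sum like powers of \<open>1 / 2\<close>.\<close>
  have "\<exists>M. \<forall>m\<ge>M. \<forall>n\<ge>M. dist (u m) (u n) < (1 / 4) ^ k" for k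
    by (rule metric_CauchyD[OF u]) simp
  then obtain M where M: "\<And>k m n. M k \<le> m \<Longrightarrow> M k \<le> n \<Longrightarrow> dist (u m) (u n) < (1 / 4) ^ k"
    by metis
  \<comment> \<open>Partial sums make the indices monotone, so both \<open>r k\<close> and
    \<open>r (Suc k)\<close> are at least \<open>M k\<close>.\<close>
  define r where "r = (\<lambda>k. \<Sum>i\<le>k. M i)"
  have r: "M k \<le> r k" "r k \<le> r (Suc k)" for k by (auto simp: r_def intro: member_le_sum)
  define w where "w = (\<lambda>k. u (r k))"
  define a where "a = (\<lambda>k. w (Suc k) - w k)"
  have quarter: "(1 / 4 :: real) ^ k \<le> (1 / 2) ^ k" for k by (intro power_mono) auto
  have a4: "norm (a k) \<le> (1 / 4) ^ k" for k
    using M[of k "r (Suc k)" "r k"] r(1)[of k] r(2)[of k] by (simp add: a_def w_def dist_norm)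
  have a2: "norm (a k) \<le> (1 / 2) ^ k" for k using a4[of k] quarter[of k] by linarith
  have u_w: "norm (w k - u n) \<le> (1 / 4) ^ k" if "r k \<le> n" for k n
    using M[of k "r k" n] r[of k] that by (simp add: w_def dist_norm)
  have w_sum: "w m = w 0 + (\<Sum>k<m. a k)" for m
    unfolding a_def by (simp add: sum_lessThan_telescope)
  \<comment> \<open>Step \<open>k\<close> is complete where \<open>D z\<close> is at most
    \<open>(1 / 2) ^ k\<close> and absent where it is at least twice that.\<close>
  define \<psi> where "\<psi> = (\<lambda>k z. max 0 (min 1 (2 - 2 ^ k * D z)))"
  have \<psi>: "0 \<le> \<psi> k z" "\<psi> k z \<le> 1" for k z by (auto simp: \<psi>_def)
  have \<psi>_lip: "\<bar>\<psi> k z - \<psi> k z'\<bar> \<le> 2 ^ k * dist z z'" for k z z'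
  proof -
    have "\<bar>\<psi> k z - \<psi> k z'\<bar> \<le> \<bar>2 ^ k * D z - 2 ^ k * D z'\<bar>" unfolding \<psi>_def by linarith
    also have "\<dots> = 2 ^ k * \<bar>D z - D z'\<bar>" by (simp add: abs_mult flip: right_diff_distrib)
    also have "\<dots> \<le> 2 ^ k * dist z z'" using D_lip by (intro mult_left_mono) auto
    finally show ?thesis .
  qed
  define f where "f = (\<lambda>z. w 0 + (\<Sum>k. \<psi> k z *\<^sub>R a k))"
  have f_eq: "\<exists>K. \<forall>n\<ge>K. f z = w 0 + (\<Sum>k<n. \<psi> k z *\<^sub>R a k)" for z
  proof -
    obtain K :: nat where "2 / D z < 2 ^ K" using real_arch_pow[of 2 "2 / D z"] by auto
    then have K: "2 < 2 ^ K * D z" using D_pos[of z] by (simp add: divide_less_eq)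
    have "\<psi> k z = 0" if "K \<le> k" for k
    proof -
      have "(2::real) ^ K * D z \<le> 2 ^ k * D z"
        using that D_pos[of z] by (intro mult_right_mono power_increasing) auto
      then show ?thesis using K by (simp add: \<psi>_def)
    qed
    then have "(\<Sum>k. \<psi> k z *\<^sub>R a k) = (\<Sum>k<n. \<psi> k z *\<^sub>R a k)" if "K \<le> n" for n
      using that by (intro suminf_finite) auto
    then show ?thesis unfolding f_def by auto
  qed
  have "f \<in> lip_ball (norm (w 0) + 2)"
  proof (rule lip_ballI)
    fix z z'
    obtain K K' where "\<And>n. K \<le> n \<Longrightarrow> f z = w 0 + (\<Sum>k<n. \<psi> k z *\<^sub>R a k)"
      "\<And>n. K' \<le> n \<Longrightarrow> f z' = w 0 + (\<Sum>k<n. \<psi> k z' *\<^sub>R a k)"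
      using f_eq[of z] f_eq[of z'] by blast
    then obtain n where n: "f z = w 0 + (\<Sum>k<n. \<psi> k z *\<^sub>R a k)"
      "f z' = w 0 + (\<Sum>k<n. \<psi> k z' *\<^sub>R a k)"
      using max.cobounded1 max.cobounded2 by blast
    have half: "(\<Sum>k<n. (1 / 2 :: real) ^ k) \<le> 2"
      using sum_half_powers_le[of 0 n] by (simp add: atLeast0LessThan)
    have "norm (\<Sum>k<n. \<psi> k z *\<^sub>R a k) \<le> (\<Sum>k<n. (1 / 2) ^ k)"
    proof (rule sum_norm_le)
      show "norm (\<psi> k z *\<^sub>R a k) \<le> (1 / 2) ^ k" for k
        using \<psi>[of k z] a2[of k] mult_mono[of "\<psi> k z" 1 "norm (a k)" "(1 / 2) ^ k"] by simp
    qed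
    then show "norm (f z) \<le> norm (w 0) + 2"
      unfolding n(1) using half by (intro norm_triangle_mono) auto
    have "f z - f z' = (\<Sum>k<n. (\<psi> k z - \<psi> k z') *\<^sub>R a k)"
      unfolding n by (simp add: sum_subtractf algebra_simps)
    also have "norm \<dots> \<le> (\<Sum>k<n. (1 / 2) ^ k * dist z z')"
    proof (rule sum_norm_le)
      fix k
      have "norm ((\<psi> k z - \<psi> k z') *\<^sub>R a k) \<le> (2 ^ k * dist z z') * (1 / 4) ^ k"
        using \<psi>_lip[of k z z'] a4[of k] by (simp only: norm_scaleR, intro mult_mono) auto
      also have "\<dots> = (2 * (1 / 4)) ^ k * dist z z'" by (simp only: power_mult_distrib ac_simps)
      finally show "norm ((\<psi> k z - \<psi> k z') *\<^sub>R a k) \<le> (1 / 2) ^ k * dist z z'" by simp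
    qed
    also have "\<dots> = (\<Sum>k<n. (1 / 2) ^ k) * dist z z'" by (simp add: sum_distrib_right)
    also have "\<dots> \<le> (norm (w 0) + 2) * dist z z'"
      using half norm_ge_zero[of "w 0"] by (intro mult_right_mono) (linarith, simp)
    finally show "norm (f z - f z') \<le> (norm (w 0) + 2) * dist z z'" .
  qed
  then have "f \<in> Lip" by (rule lip_ball_Lip)
  \<comment> \<open>This close to the missing limit the first \<open>m\<close> steps are complete
    and telescope to \<open>w m\<close>; the later ones are bounded by a geometric tail.\<close>
  moreover have near: "norm (f z - w m) \<le> 2 * (1 / 2) ^ m" if z: "D z \<le> (1 / 2) ^ m" for z m
  proof -
    obtain K where "\<And>n. K \<le> n \<Longrightarrow> f z = w 0 + (\<Sum>k<n. \<psi> k z *\<^sub>R a k)"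
      using f_eq[of z] by blast
    then obtain n where n: "f z = w 0 + (\<Sum>k<n. \<psi> k z *\<^sub>R a k)" "m \<le> n"
      using max.cobounded1[of K m] max.cobounded2[of m K] by blast
    have one: "\<psi> k z = 1" if "k < m" for k
    proof -
      have "2 ^ k * D z \<le> 2 ^ m * (1 / 2) ^ m"
        using that z D_pos[of z] by (intro mult_mono power_increasing) auto
      also have "\<dots> = 1" by (simp flip: power_mult_distrib)
      finally show ?thesis by (simp add: \<psi>_def)
    qed
    have "{..<n} = {..<m} \<union> {m..<n}" using n by auto
    then have "(\<Sum>k<n. \<psi> k z *\<^sub>R a k) = (\<Sum>k<m. \<psi> k z *\<^sub>R a k) + (\<Sum>k\<in>{m..<n}. \<psi> k z *\<^sub>R a k)"
      by (simp add: sum.union_disjoint ivl_disj_int)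
    then have "f z - w m = (\<Sum>k\<in>{m..<n}. \<psi> k z *\<^sub>R a k)"
      unfolding n(1) using w_sum[of m] one by simp
    also have "norm \<dots> \<le> (\<Sum>k\<in>{m..<n}. (1 / 2) ^ k)"
    proof (rule sum_norm_le)
      show "norm (\<psi> k z *\<^sub>R a k) \<le> (1 / 2) ^ k" for k
        using \<psi>[of k z] a2[of k] mult_mono[of "\<psi> k z" 1 "norm (a k)" "(1 / 2) ^ k"] by simp
    qed
    also have "\<dots> \<le> 2 * (1 / 2) ^ m" by (rule sum_half_powers_le)
    finally show ?thesis .
  qed
  moreover have "(\<lambda>n. f (x n) - u n) \<longlonglongrightarrow> 0"
  proof (rule LIMSEQ_I)
    fix e :: real assume "0 < e"
    then obtain m where m: "(1 / 2 :: real) ^ m < e / 3"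
      using real_arch_pow_inv[of "e / 3" "1 / 2"] by auto
    obtain Q where Q: "\<And>n. Q \<le> n \<Longrightarrow> D (x n) \<le> (1 / 2) ^ m"
      using D_x[of "(1 / 2) ^ m"] by auto
    have "norm (f (x n) - u n - 0) < e" if "max Q (r m) \<le> n" for n
    proof -
      have "norm (f (x n) - u n) \<le> norm (f (x n) - w m) + norm (w m - u n)"
        by (rule order_trans[OF _ norm_triangle_ineq]) simp
      then show ?thesis
        using near[OF Q, of n] u_w[of m n] quarter[of m] m that by simp
    qed
    then show "\<exists>no. \<forall>n\<ge>no. norm (f (x n) - u n - 0) < e" by blast
  qed
  ultimately show ?thesis by blast
qed

section \<open>Peak functions\<close>

text \<open>Only real scalars occur here; those of \<open>K\<close> return in the final theorem.
  What is assumed of \<open>T\<close> alone is proved below for \<open>S\<close>, Property P last,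
  so that the locale can be interpreted with \<open>S\<close> and \<open>T\<close>
  exchanged.\<close>

locale lip_isometry =
  fixes T :: "('x::metric_space \<Rightarrow> 'e::real_normed_vector) \<Rightarrow> ('y::metric_space \<Rightarrow> 'f::real_normed_vector)"
    and S :: "('y \<Rightarrow> 'f) \<Rightarrow> ('x \<Rightarrow> 'e)"
  assumes convex_E: "strictly_convex TYPE('e)"
    and convex_F: "strictly_convex TYPE('f)"
    and T_Lip: "f \<in> Lip \<Longrightarrow> T f \<in> Lip"
    and S_Lip: "g \<in> Lip \<Longrightarrow> S g \<in> Lip"
    and S_T: "f \<in> Lip \<Longrightarrow> S (T f) = f"
    and T_S: "g \<in> Lip \<Longrightarrow> T (S g) = g"
    and T_add: "f \<in> Lip \<Longrightarrow> f' \<in> Lip \<Longrightarrow> T (\<lambda>x. f x + f' x) = (\<lambda>y. T f y + T f' y)"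
    and T_scale: "f \<in> Lip \<Longrightarrow> T (\<lambda>x. c *\<^sub>R f x) = (\<lambda>y. c *\<^sub>R T f y)"
    and T_ball: "f \<in> Lip \<Longrightarrow> T f \<in> lip_ball C \<longleftrightarrow> f \<in> lip_ball C"
    and T_P: "\<exists>e. T (\<lambda>_. e) y \<noteq> 0"
begin

lemma T_diff:
  assumes "f \<in> Lip" "f' \<in> Lip"
  shows "T (\<lambda>x. f x - f' x) = (\<lambda>y. T f y - T f' y)"
  using T_add[OF assms(1) Lip_scale[OF assms(2), of "-1"]] T_scale[OF assms(2), of "-1"] by simp

lemma T_lip_ball: "f \<in> lip_ball C \<Longrightarrow> T f \<in> lip_ball C"
  using T_ball lip_ball_Lip by blast

lemma S_add:
  assumes "g \<in> Lip" "g' \<in> Lip"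
  shows "S (\<lambda>x. g x + g' x) = (\<lambda>y. S g y + S g' y)"
proof -
  have "T (\<lambda>y. S g y + S g' y) = (\<lambda>x. g x + g' x)"
    using T_add[OF S_Lip S_Lip] assms T_S by simp
  then show ?thesis
    using S_T[OF Lip_add[OF S_Lip S_Lip]] assms by metis
qed

lemma S_scale:
  assumes "g \<in> Lip"
  shows "S (\<lambda>x. c *\<^sub>R g x) = (\<lambda>y. c *\<^sub>R S g y)"
proof -
  have "T (\<lambda>y. c *\<^sub>R S g y) = (\<lambda>x. c *\<^sub>R g x)"
    using T_scale[OF S_Lip] assms T_S by simp
  then show ?thesis
    using S_T[OF Lip_scale[OF S_Lip]] assms by metis
qed

lemma S_ball: "g \<in> Lip \<Longrightarrow> S g \<in> lip_ball C \<longleftrightarrow> g \<in> lip_ball C"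
  using T_ball[OF S_Lip] T_S by metis

lemma T_const_scale: "T (\<lambda>_. c *\<^sub>R e) y = c *\<^sub>R T (\<lambda>_. e) y"
  using T_scale[OF Lip_const, of c e] by meson

lemma T_const_norm_le: "norm (T (\<lambda>_. e) y) \<le> norm e"
  by (rule lip_ball_norm[OF T_lip_ball[OF lip_ball_const]]) simp

lemma exists_unit_E: "\<exists>e. norm e = 1 \<and> T (\<lambda>_. e) y \<noteq> 0"
proof -
  obtain e where e: "T (\<lambda>_. e) y \<noteq> 0" using T_P by blast
  then have "e \<noteq> 0" using T_const_norm_le[of e y] by auto
  then show ?thesis
    using e T_const_scale[of "1 / norm e" e y] by (intro exI[of _ "(1 / norm e) *\<^sub>R e"]) auto
qed

lemma exists_unit_F: "\<exists>v::'f. norm v = 1"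
proof -
  obtain e where e: "T (\<lambda>_. e) y \<noteq> 0" using T_P by blast
  then show ?thesis
    by (intro exI[of _ "(1 / norm (T (\<lambda>_. e) y)) *\<^sub>R T (\<lambda>_. e) y"]) auto
qed

text \<open>The gap between the slope bound 1 and the norm \<open>N\<close> is room for
  perturbation: a small multiple of any function in \<open>Lip\<close> can be added without raising
  the slope above \<open>N\<close>. The last clause keeps \<open>T \<phi>\<close> away from norm
  \<open>N\<close> except near \<open>y\<close>.\<close>

definition peak :: "'y \<Rightarrow> ('x \<Rightarrow> 'e) \<Rightarrow> real \<Rightarrow> bool" where
  "peak y \<phi> N \<longleftrightarrow> 1 < N \<and> \<phi> \<in> lip_ball N \<and> (\<forall>x x'. norm (\<phi> x - \<phi> x') \<le> dist x x') \<and>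
     (\<forall>z z'. norm (T \<phi> z - T \<phi> z') \<le> dist z z') \<and> norm (T \<phi> y) = N \<and>
     (\<forall>z. norm (T \<phi> z) \<le> N - min (dist z y / 4) (1 / 2))"

text \<open>The tent has slope \<open>1 / 2\<close> and the added constant size \<open>t\<close>.
  The bound \<open>t \<le> 1 / 8\<close> keeps the total slope below 1 and the decay rate
  \<open>N - 3 * t\<close> above \<open>1 / 2\<close>.\<close>

lemma exists_peak:
  assumes v: "norm v = 1" and t: "0 < t" "t \<le> 1 / 8"
  shows "\<exists>\<phi> N. peak y \<phi> N \<and> norm (T \<phi> y - v) \<le> t"
proof -
  obtain e where e: "norm e = 1" "1 < norm (v + t *\<^sub>R T (\<lambda>_. e) y)"
  proof -
    obtain e where e: "norm e = 1" "T (\<lambda>_. e) y \<noteq> 0" using exists_unit_E by blast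
    let ?j = "t *\<^sub>R T (\<lambda>_. e) y"
    have m: "T (\<lambda>_. - e) y = - T (\<lambda>_. e) y"
      using T_const_scale[of "-1" e y] by simp
    \<comment> \<open>One of \<open>e\<close> and \<open>- e\<close> raises the norm above 1:
      otherwise the unit vector \<open>v\<close> would be the midpoint of two distinct vectors of
      the unit ball.\<close>
    have "\<not> (norm (v + ?j) \<le> 1 \<and> norm (v - ?j) \<le> 1)"
    proof
      assume "norm (v + ?j) \<le> 1 \<and> norm (v - ?j) \<le> 1"
      moreover have "v + ?j + (v - ?j) = 2 *\<^sub>R v" by (simp add: scaleR_2)
      ultimately have "v + ?j = v - ?j"
        using v by (intro strictly_convex_eq[OF convex_F, of _ 1]) auto
      then have "?j + ?j = 0" by (simp add: eq_neg_iff_add_eq_0)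
      then have "2 *\<^sub>R ?j = 0" by (simp only: scaleR_2)
      then show False using e t by simp
    qed
    then show thesis
      using that[of e] that[of "- e"] e m by fastforce
  qed
  let ?p = "\<lambda>z. tent y 2 z *\<^sub>R ((1 / 2) *\<^sub>R v)"
  have pL: "?p \<in> Lip" by (rule tent_Lip) simp
  define c where "c = T (\<lambda>_. e)"
  define \<phi> where "\<phi> = (\<lambda>x. S ?p x + t *\<^sub>R e)"
  define N where "N = norm (v + t *\<^sub>R c y)"
  have N1: "1 < N" using e by (simp add: N_def c_def)
  have phiL: "\<phi> \<in> Lip" unfolding \<phi>_def by (intro Lip_add Lip_const S_Lip pL)
  have T\<phi>: "T \<phi> = (\<lambda>z. ?p z + t *\<^sub>R c z)"
    unfolding \<phi>_def using T_add[OF S_Lip[OF pL] Lip_const] T_S[OF pL] T_scale[OF Lip_const, of t e]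
    by (simp add: c_def)
  have T\<phi>y: "T \<phi> y = v + t *\<^sub>R c y" by (simp add: T\<phi> tent_def)
  have cB: "c \<in> lip_ball 1" unfolding c_def using e by (intro T_lip_ball lip_ball_const) simp
  have p_le: "norm (?p z - ?p z') \<le> 1 / 2 * dist z z'" for z z'
  proof -
    have "?p z - ?p z' = (tent y 2 z - tent y 2 z') *\<^sub>R ((1 / 2) *\<^sub>R v)"
      by (simp add: algebra_simps)
    then show ?thesis
      using lipschitz_onD[OF tent_lipschitz, of z z' y 2] v by (simp add: dist_real_def)
  qed
  have T\<phi>_lip: "norm (T \<phi> z - T \<phi> z') \<le> dist z z'" for z z'
  proof -
    have "T \<phi> z - T \<phi> z' = (?p z - ?p z') + t *\<^sub>R (c z - c z')"
      by (simp add: T\<phi> algebra_simps)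
    also have "norm \<dots> \<le> 1 / 2 * dist z z' + t * (1 * dist z z')"
      using t lip_ball_diff[OF cB, of z z'] by (intro norm_triangle_mono p_le) (simp add: mult_left_mono)
    also have "\<dots> = (1 / 2 + t) * dist z z'" by (simp add: algebra_simps)
    also have "\<dots> \<le> 1 * dist z z'" using t by (intro mult_right_mono) auto
    finally show ?thesis by simp
  qed
  have decay: "norm (T \<phi> z) \<le> N - min (dist z y / 4) (1 / 2)" for z
  proof (cases "dist z y \<le> 2")
    case True
    define d where "d = dist z y / 2"
    have d: "0 \<le> d" "d \<le> 1" using True by (auto simp: d_def)
    have pz: "?p z = (1 - d) *\<^sub>R v" using True by (simp add: tent_def d_def algebra_simps diff_divide_distrib)
    \<comment> \<open>The value at \<open>z\<close> is \<open>1 - d\<close> times the value at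
      \<open>y\<close>, up to an error of norm at most \<open>3 * t * d\<close>.\<close>
    have "T \<phi> z = (1 - d) *\<^sub>R (v + t *\<^sub>R c y) + (t *\<^sub>R (c z - c y) + (t * d) *\<^sub>R c y)"
      unfolding T\<phi> pz by (simp add: algebra_simps)
    also have "norm \<dots> \<le> (1 - d) * N + (t * (1 * dist z y) + t * d * 1)"
      using t d lip_ball_diff[OF cB, of z y] lip_ball_norm[OF cB, of y]
      by (intro norm_triangle_mono) (auto simp: N_def intro!: mult_left_mono mult_left_le)
    also have "\<dots> = N - d * (N - 3 * t)" by (simp add: d_def field_simps)
    also have "\<dots> \<le> N - d * (1 / 2)"
      using d t N1 by (intro diff_left_mono mult_left_mono) auto
    finally show ?thesis by (simp add: d_def)
  next
    case False
    then have "T \<phi> z = t *\<^sub>R c z" by (simp add: T\<phi> tent_def)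
    moreover have "t * norm (c z) \<le> t * 1"
      using t lip_ball_norm[OF cB, of z] by (intro mult_left_mono) auto
    ultimately have "norm (T \<phi> z) \<le> t" using t by simp
    then show ?thesis using N1 t by linarith
  qed
  have T\<phi>N: "norm (T \<phi> z) \<le> N" for z
    using decay[of z] zero_le_dist[of z y] by linarith
  have "T \<phi> \<in> lip_ball N"
  proof (rule lip_ballI)
    fix z z'
    show "norm (T \<phi> z) \<le> N" by (rule T\<phi>N)
    show "norm (T \<phi> z - T \<phi> z') \<le> N * dist z z'"
      using T\<phi>_lip[of z z'] mult_right_mono[of 1 N "dist z z'"] N1 by simp
  qed
  then have \<phi>N: "\<phi> \<in> lip_ball N" using T_ball phiL by blast
  have "?p \<in> lip_ball 1"
  proof (rule lip_ballI)
    fix z z'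
    show "norm (?p z) \<le> 1" using v tent_bounds[of 2 y z] by simp
    show "norm (?p z - ?p z') \<le> 1 * dist z z'" using p_le[of z z'] zero_le_dist[of z z'] by linarith
  qed
  then have "S ?p \<in> lip_ball 1" using S_ball pL by blast
  \<comment> \<open>Adding a constant leaves differences unchanged, so \<open>\<phi>\<close> keeps
    the slope bound 1 although its norm exceeds 1.\<close>
  then have "norm (\<phi> x - \<phi> x') \<le> dist x x'" for x x'
    using lip_ball_diff[of "S ?p" 1 x x'] by (simp add: \<phi>_def)
  then have "peak y \<phi> N"
    unfolding peak_def using N1 \<phi>N T\<phi>_lip decay T\<phi>y by (simp add: N_def)
  moreover have "norm (T \<phi> y - v) \<le> t"
    using t lip_ball_norm[OF cB, of y] by (simp add: T\<phi>y mult_left_le)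
  ultimately show ?thesis by blast
qed

lemma peak_Lip: "peak y \<phi> N \<Longrightarrow> \<phi> \<in> Lip"
  unfolding peak_def using lip_ball_Lip by blast

text \<open>The slope of \<open>\<phi>\<close> is at most 1, so its norm \<open>N > 1\<close> must
  come from its values; otherwise \<open>\<phi>\<close>, and with it \<open>T \<phi>\<close>, would
  lie in a smaller ball.\<close>

lemma peak_nearly_attained:
  assumes "peak y \<phi> N" "\<epsilon> > 0"
  shows "\<exists>x. N - \<epsilon> < norm (\<phi> x)"
proof (rule ccontr)
  assume "\<not> ?thesis"
  then have le: "norm (\<phi> x) \<le> N - \<epsilon>" for x by (meson not_less)
  have "\<phi> \<in> lip_ball (max 1 (N - \<epsilon>))"
  proof (rule lip_ballI)
    fix x x'
    show "norm (\<phi> x) \<le> max 1 (N - \<epsilon>)" using le[of x] by simp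
    have "norm (\<phi> x - \<phi> x') \<le> 1 * dist x x'" using assms by (simp add: peak_def)
    also have "\<dots> \<le> max 1 (N - \<epsilon>) * dist x x'" by (intro mult_right_mono) auto
    finally show "norm (\<phi> x - \<phi> x') \<le> max 1 (N - \<epsilon>) * dist x x'" .
  qed
  then have "norm (T \<phi> y) \<le> max 1 (N - \<epsilon>)" by (intro lip_ball_norm T_lip_ball)
  then show False using assms by (auto simp: peak_def)
qed

section \<open>Annihilation at the peak and concentration\<close>

text \<open>Where \<open>\<psi>\<close> vanishes, \<open>\<phi>\<close> and its perturbation
  \<open>h\<close> agree, so their sum \<open>g\<close> has norm \<open>2 * N\<close>. The slope of
  \<open>T g\<close> is at most \<open>1 + N < 2 * N\<close>, so \<open>T g\<close> nearly attains
  \<open>2 * N\<close> by its values, and by the decay of \<open>T \<phi>\<close> this happens near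
  \<open>y\<close>. Strict convexity then gives \<open>T \<phi> y = T h y\<close>.\<close>

lemma peak_annihilates:
  assumes pk: "peak y \<phi> N" and \<psi>: "\<psi> \<in> Lip" and c: "0 < c"
    and le: "\<And>x. norm (\<phi> x - c *\<^sub>R \<psi> x) \<le> N"
    and zero: "\<And>\<epsilon>. 0 < \<epsilon> \<Longrightarrow> \<exists>x. N - \<epsilon> < norm (\<phi> x) \<and> \<psi> x = 0"
  shows "T \<psi> y = 0"
proof -
  note \<phi> = peak_Lip[OF pk]
  have N1: "1 < N" and \<phi>N: "\<And>x. norm (\<phi> x) \<le> N"
    and \<phi>1: "\<And>x x'. norm (\<phi> x - \<phi> x') \<le> dist x x'"
    and T1: "\<And>z z'. norm (T \<phi> z - T \<phi> z') \<le> dist z z'" and Ty: "norm (T \<phi> y) = N"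
    and decay: "\<And>z. norm (T \<phi> z) \<le> N - min (dist z y / 4) (1 / 2)"
    using pk lip_ball_norm by (auto simp: peak_def)
  obtain L where L: "0 < L" "\<psi> \<in> lip_ball L" using Lip_lip_ball[OF \<psi>] .
  \<comment> \<open>The bound by \<open>c\<close> controls the values of \<open>h\<close> by
    convexity; the bound by \<open>(N - 1) / L\<close> keeps its slope at most
    \<open>N\<close>.\<close>
  define s where "s = min c ((N - 1) / L)"
  have s: "0 < s" "s \<le> c" "1 + s * L \<le> N"
    using c L N1 by (auto simp: s_def min_def field_simps)
  define h where "h = (\<lambda>x. \<phi> x - s *\<^sub>R \<psi> x)"
  have hL: "h \<in> Lip" unfolding h_def by (intro Lip_diff Lip_scale \<phi> \<psi>)
  have hN: "h \<in> lip_ball N"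
  proof (rule lip_ballI)
    fix x x'
    have "h x = (1 - s / c) *\<^sub>R \<phi> x + (s / c) *\<^sub>R (\<phi> x - c *\<^sub>R \<psi> x)"
      using c by (simp add: h_def algebra_simps)
    also have "norm \<dots> \<le> (1 - s / c) * N + (s / c) * N"
      using s c \<phi>N[of x] le[of x]
      by (intro norm_triangle_mono) (auto intro!: mult_left_mono divide_right_mono)
    also have "\<dots> = N" by (simp add: algebra_simps)
    finally show "norm (h x) \<le> N" .
    have "h x - h x' = (\<phi> x - \<phi> x') - s *\<^sub>R (\<psi> x - \<psi> x')" by (simp add: h_def algebra_simps)
    also have "norm \<dots> \<le> dist x x' + s * (L * dist x x')"
      using \<phi>1[of x x'] lip_ball_diff[OF L(2), of x x'] s
      by (intro order_trans[OF norm_triangle_ineq4 add_mono]) (auto intro!: mult_left_mono)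
    also have "\<dots> = (1 + s * L) * dist x x'" by (simp add: algebra_simps)
    also have "\<dots> \<le> N * dist x x'" using s by (intro mult_right_mono) auto
    finally show "norm (h x - h x') \<le> N * dist x x'" .
  qed
  then have ThN: "T h \<in> lip_ball N" by (rule T_lip_ball)
  define g where "g = (\<lambda>x. \<phi> x + h x)"
  have Tg: "T g = (\<lambda>z. T \<phi> z + T h z)" unfolding g_def by (rule T_add[OF \<phi> hL])
  have gL: "g \<in> Lip" unfolding g_def by (intro Lip_add \<phi> hL)
  have Tg_lip: "norm (T g z - T g z') \<le> (1 + N) * dist z z'" for z z'
  proof -
    have "T g z - T g z' = (T \<phi> z - T \<phi> z') + (T h z - T h z')" by (simp add: Tg)
    also have "norm \<dots> \<le> dist z z' + N * dist z z'"
      by (intro norm_triangle_mono T1 lip_ball_diff[OF ThN])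
    finally show ?thesis by (simp add: algebra_simps)
  qed
  have near: "\<exists>z. 2 * N - \<epsilon> < norm (T g z)" if "0 < \<epsilon>" for \<epsilon>
  proof (rule ccontr)
    assume "\<not> ?thesis"
    then have le: "norm (T g z) \<le> 2 * N - \<epsilon>" for z by (meson not_less)
    define M where "M = max (1 + N) (2 * N - \<epsilon>)"
    have "T g \<in> lip_ball M"
    proof (rule lip_ballI)
      fix z z'
      show "norm (T g z) \<le> M" using le[of z] by (simp add: M_def)
      show "norm (T g z - T g z') \<le> M * dist z z'"
        using Tg_lip[of z z'] mult_right_mono[of "1 + N" M "dist z z'"] by (simp add: M_def)
    qed
    then have gM: "g \<in> lip_ball M" using T_ball gL by blast
    \<comment> \<open>With this tolerance \<open>\<phi> x\<close> has norm above
      \<open>M / 2\<close>, so \<open>g x\<close> has norm above \<open>M\<close>.\<close>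
    have "0 < N - M / 2" using N1 that by (auto simp: M_def)
    then obtain x where x: "N - (N - M / 2) < norm (\<phi> x)" "\<psi> x = 0" using zero by blast
    have "g x = 2 *\<^sub>R \<phi> x" using x by (simp add: g_def h_def scaleR_2)
    then show False using lip_ball_norm[OF gM, of x] x by simp
  qed
  have "2 * N \<le> norm (T g y)"
  proof (rule field_le_epsilon)
    fix \<eta> :: real assume \<eta>: "0 < \<eta>"
    \<comment> \<open>The loss at \<open>y\<close> is \<open>\<epsilon>\<close> for near attainment
      at \<open>z\<close> plus the slope \<open>1 + N\<close> times the distance
      \<open>4 * \<epsilon>\<close>. Taking \<open>\<epsilon> \<le> 1 / 2\<close> excludes the
      constant branch of the decay bound.\<close>
    define K where "K = 1 + (1 + N) * 4"
    have K: "0 < K" using N1 by (simp add: K_def)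
    define \<epsilon> where "\<epsilon> = min (1 / 2) (\<eta> / K)"
    have \<epsilon>: "0 < \<epsilon>" "\<epsilon> \<le> 1 / 2" "\<epsilon> \<le> \<eta> / K"
      unfolding \<epsilon>_def by (use \<eta> K in simp, rule min.cobounded1, rule min.cobounded2)
    then have \<epsilon>K: "\<epsilon> * K \<le> \<eta>" using K by (simp add: pos_le_divide_eq)
    obtain z where z: "2 * N - \<epsilon> < norm (T g z)" using near \<epsilon> by blast
    have "norm (T g z) \<le> norm (T \<phi> z) + N"
      unfolding Tg by (intro norm_triangle_mono lip_ball_norm[OF ThN]) simp
    then have "min (dist z y / 4) (1 / 2) < \<epsilon>" using z decay[of z] by linarith
    then have d: "dist z y < 4 * \<epsilon>" using \<epsilon> by (simp add: min_def split: if_splits)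
    have "norm (T g z) - norm (T g y) \<le> norm (T g z - T g y)" by (rule norm_triangle_ineq2)
    also have "\<dots> \<le> (1 + N) * (4 * \<epsilon>)"
      using Tg_lip[of z y] d N1 mult_left_mono[of "dist z y" "4 * \<epsilon>" "1 + N"] by linarith
    finally show "2 * N \<le> norm (T g y) + \<eta>"
      using z \<epsilon>K by (simp add: K_def algebra_simps)
  qed
  then have "T \<phi> y = T h y"
    using Ty lip_ball_norm[OF ThN, of y]
    by (intro strictly_convex_eq[OF convex_F, of _ N]) (auto simp: Tg)
  moreover have "T h y = T \<phi> y - s *\<^sub>R T \<psi> y"
    unfolding h_def using T_diff[OF \<phi> Lip_scale[OF \<psi>]] T_scale[OF \<psi>] by simp
  ultimately show ?thesis using s by simp
qed

text \<open>Such a \<open>b\<close> would split \<open>\<phi>\<close> into two functions,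
  \<open>b\<close> times \<open>\<phi>\<close> and the rest, both annihilated at \<open>y\<close>,
  whereas \<open>T \<phi> y\<close> has norm \<open>N\<close>.\<close>

lemma peak_no_separation:
  fixes b :: "'x \<Rightarrow> real"
  assumes pk: "peak y \<phi> N" and b: "\<And>x. 0 \<le> b x" "\<And>x. b x \<le> 1" "B-lipschitz_on UNIV b"
    and b0: "\<And>\<epsilon>. 0 < \<epsilon> \<Longrightarrow> \<exists>x. N - \<epsilon> < norm (\<phi> x) \<and> b x = 0"
    and b1: "\<And>\<epsilon>. 0 < \<epsilon> \<Longrightarrow> \<exists>x. N - \<epsilon> < norm (\<phi> x) \<and> b x = 1"
  shows False
proof -
  note \<phi> = peak_Lip[OF pk]
  have le: "norm (\<phi> x) \<le> N" for x using pk lip_ball_norm by (auto simp: peak_def)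
  have sc: "norm (s *\<^sub>R \<phi> x) \<le> N" if "0 \<le> s" "s \<le> 1" for s x
    using that le[of x] mult_mono[of s 1 "norm (\<phi> x)" N] by simp
  have L1: "(\<lambda>x. b x *\<^sub>R \<phi> x) \<in> Lip"
    by (rule Lip_mult[OF \<phi> _ b(3), where M = 1]) (use b in \<open>auto simp: abs_le_iff intro: order_trans[of _ 0]\<close>)
  have L2: "(\<lambda>x. \<phi> x - b x *\<^sub>R \<phi> x) \<in> Lip" by (intro Lip_diff \<phi> L1)
  have "T (\<lambda>x. b x *\<^sub>R \<phi> x) y = 0"
  proof (rule peak_annihilates[OF pk L1, of 1])
    show "norm (\<phi> x - 1 *\<^sub>R b x *\<^sub>R \<phi> x) \<le> N" for x
      using sc[of "1 - b x" x] b(1,2)[of x] by (simp add: algebra_simps)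
    show "\<exists>x. N - \<epsilon> < norm (\<phi> x) \<and> b x *\<^sub>R \<phi> x = 0" if "0 < \<epsilon>" for \<epsilon>
      using b0[OF that] by auto
  qed simp
  moreover have "T (\<lambda>x. \<phi> x - b x *\<^sub>R \<phi> x) y = 0"
  proof (rule peak_annihilates[OF pk L2, of 1])
    show "norm (\<phi> x - 1 *\<^sub>R (\<phi> x - b x *\<^sub>R \<phi> x)) \<le> N" for x
      using sc[of "b x" x] b(1,2)[of x] by simp
    show "\<exists>x. N - \<epsilon> < norm (\<phi> x) \<and> \<phi> x - b x *\<^sub>R \<phi> x = 0" if "0 < \<epsilon>" for \<epsilon>
      using b1[OF that] by auto
  qed simp
  ultimately have "T \<phi> y = 0" using T_diff[OF \<phi> L1] by simp
  then show False using pk by (auto simp: peak_def)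
qed

text \<open>Otherwise there is a sequence of near maximizers, \<open>\<rho>\<close>-separated and of
  increasing quality; a Lipschitz function equal to 1 at its even terms and 0 at its odd terms is
  impossible by \<open>peak_no_separation\<close>.\<close>

lemma peak_concentrated:
  assumes pk: "peak y \<phi> N" and \<rho>: "0 < \<rho>"
  shows "\<exists>\<epsilon>>0. \<exists>a. \<forall>x. N - \<epsilon> < norm (\<phi> x) \<longrightarrow> dist x a \<le> 2 * \<rho>"
proof (rule ccontr)
  assume "\<not> ?thesis"
  then have spread: "\<exists>x. N - \<epsilon> < norm (\<phi> x) \<and> 2 * \<rho> < dist x a" if "0 < \<epsilon>" for \<epsilon> a
    using that by (meson not_less)
  \<comment> \<open>If near maximizers of every level came within \<open>\<rho>\<close> of
    \<open>a\<close>, the cutoff at \<open>a\<close> would separate them from those beyond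
    \<open>2 * \<rho>\<close>.\<close>
  have "\<exists>\<epsilon>>0. \<forall>x. N - \<epsilon> < norm (\<phi> x) \<longrightarrow> \<rho> < dist x a" for a
  proof (rule ccontr)
    assume "\<not> ?thesis"
    then have near: "\<exists>x. N - \<epsilon> < norm (\<phi> x) \<and> dist x a \<le> \<rho>" if "0 < \<epsilon>" for \<epsilon>
      using that by (meson not_less)
    show False
    proof (rule peak_no_separation[OF pk, of "cutoff a \<rho>"])
      show "\<exists>x. N - \<epsilon> < norm (\<phi> x) \<and> cutoff a \<rho> x = 0" if "0 < \<epsilon>" for \<epsilon>
        using spread[OF that, of a] cutoff_props(4)[OF \<rho>] by (meson less_imp_le)
      show "\<exists>x. N - \<epsilon> < norm (\<phi> x) \<and> cutoff a \<rho> x = 1" if "0 < \<epsilon>" for \<epsilon>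
        using near[OF that] cutoff_props(3)[OF \<rho>] by meson
    qed (use cutoff_props[OF \<rho>] cutoff_lipschitz[OF \<rho>] in auto)
  qed
  then obtain r where r: "\<And>a. 0 < r a" "\<And>a x. N - r a < norm (\<phi> x) \<Longrightarrow> \<rho> < dist x a"
    by metis
  have "\<exists>s. \<forall>n::nat. N - 1 / real (Suc n) < norm (\<phi> (s n)) \<and> (\<forall>i<n. \<rho> < dist (s n) (s i))"
  proof (rule dependent_wellorder_choice)
    fix n :: nat and s :: "nat \<Rightarrow> 'x"
    \<comment> \<open>A level high enough for stage \<open>n\<close> and for avoiding every earlier
      point of the sequence.\<close>
    define \<epsilon> where "\<epsilon> = Min (insert (1 / real (Suc n)) ((\<lambda>i. r (s i)) ` {..<n}))"
    have "0 < \<epsilon>" unfolding \<epsilon>_def using r by (subst Min_gr_iff) auto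
    then obtain x where x: "N - \<epsilon> < norm (\<phi> x)" using peak_nearly_attained[OF pk] by blast
    have "\<epsilon> \<le> 1 / real (Suc n)" unfolding \<epsilon>_def by (rule Min_le) auto
    moreover have "\<epsilon> \<le> r (s i)" if "i < n" for i
      unfolding \<epsilon>_def using that by (intro Min_le) auto
    ultimately show "\<exists>x. N - 1 / real (Suc n) < norm (\<phi> x) \<and> (\<forall>i<n. \<rho> < dist x (s i))"
      using x r(2) by (intro exI[of _ x]) force
  qed auto
  then obtain s :: "nat \<Rightarrow> 'x" where s: "\<And>n. N - 1 / real (Suc n) < norm (\<phi> (s n))"
    and sep: "\<And>n i. i < n \<Longrightarrow> \<rho> < dist (s n) (s i)" by blast
  have sep': "\<rho> < dist (s n) (s i)" if "n \<noteq> i" for n i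
    using that sep[of i n] sep[of n i] by (cases "i < n") (auto simp: dist_commute)
  \<comment> \<open>The even terms; every odd term is at distance at least \<open>\<rho>\<close>
    from this set.\<close>
  define A where "A = range (\<lambda>k. s (2 * k))"
  define b where "b = (\<lambda>x. max 0 (1 - infdist x A / \<rho>))"
  have A: "A \<noteq> {}" by (simp add: A_def)
  show False
  proof (rule peak_no_separation[OF pk, of b])
    show "0 \<le> b x" "b x \<le> 1" for x using \<rho> infdist_nonneg[of x A] by (auto simp: b_def)
    show "(1 / \<rho>)-lipschitz_on UNIV b"
    proof (rule lipschitz_onI)
      fix x x'
      have "\<bar>infdist x A - infdist x' A\<bar> \<le> dist x x'" by (rule infdist_triangle_abs)
      then have "\<bar>infdist x A / \<rho> - infdist x' A / \<rho>\<bar> \<le> dist x x' / \<rho>"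
        using \<rho> by (simp add: abs_divide divide_right_mono flip: diff_divide_distrib)
      moreover have "\<bar>max 0 (1 - u) - max 0 (1 - w)\<bar> \<le> \<bar>u - w\<bar>" for u w :: real by linarith
      ultimately show "dist (b x) (b x') \<le> 1 / \<rho> * dist x x'"
        unfolding b_def dist_real_def by (auto intro: order_trans)
    qed (use \<rho> in simp)
    fix \<epsilon> :: real assume \<epsilon>: "0 < \<epsilon>"
    obtain n where n: "1 / real (Suc n) < \<epsilon>" using nat_approx_posE[OF \<epsilon>] .
    have mono: "1 / real (Suc m) \<le> 1 / real (Suc n)" if "n \<le> m" for m
      using that by (intro divide_left_mono) auto
    have "infdist (s (2 * n + 1)) A \<ge> \<rho>"
      unfolding infdist_notempty[OF A]
    proof (rule cINF_greatest[OF A])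
      fix a assume "a \<in> A"
      then obtain k where "a = s (2 * k)" by (auto simp: A_def)
      moreover have "2 * n + 1 \<noteq> 2 * k" by presburger
      ultimately show "\<rho> \<le> dist (s (2 * n + 1)) a" using sep'[of "2 * n + 1" "2 * k"] by simp
    qed
    then have "b (s (2 * n + 1)) = 0" using \<rho> by (simp add: b_def)
    then show "\<exists>x. N - \<epsilon> < norm (\<phi> x) \<and> b x = 0"
      using s[of "2 * n + 1"] mono[of "2 * n + 1"] n by (intro exI[of _ "s (2 * n + 1)"]) simp
    have "s (2 * n) \<in> A" by (auto simp: A_def)
    then have "b (s (2 * n)) = 1" by (simp add: b_def)
    then show "\<exists>x. N - \<epsilon> < norm (\<phi> x) \<and> b x = 1"
      using s[of "2 * n"] mono[of "2 * n"] n by (intro exI[of _ "s (2 * n)"]) simp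
  qed
qed

text \<open>Where \<open>f\<close> does not vanish, \<open>\<phi>\<close> stays
  \<open>\<epsilon>\<close> below \<open>N\<close>, which leaves room to subtract a multiple of
  \<open>f\<close> of size \<open>\<epsilon>\<close>.\<close>

lemma peak_local:
  assumes pk: "peak y \<phi> N" and f: "f \<in> Lip" and \<epsilon>: "0 < \<epsilon>"
    and zero: "\<And>x. N - \<epsilon> < norm (\<phi> x) \<Longrightarrow> f x = 0"
  shows "T f y = 0"
proof -
  obtain C where C: "0 < C" "f \<in> lip_ball C" using Lip_lip_ball[OF f] .
  have le: "norm (\<phi> x) \<le> N" for x using pk lip_ball_norm by (auto simp: peak_def)
  show ?thesis
  proof (rule peak_annihilates[OF pk f, of "\<epsilon> / C"])
    show "0 < \<epsilon> / C" using \<epsilon> C by simp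
    show "norm (\<phi> x - (\<epsilon> / C) *\<^sub>R f x) \<le> N" for x
    proof (cases "N - \<epsilon> < norm (\<phi> x)")
      case True then show ?thesis using zero le by simp
    next
      case False
      have "norm ((\<epsilon> / C) *\<^sub>R f x) \<le> (\<epsilon> / C) * C"
        using \<epsilon> C lip_ball_norm[OF C(2), of x] by (simp add: divide_le_eq)
      then have "norm ((\<epsilon> / C) *\<^sub>R f x) \<le> \<epsilon>" using C by simp
      then show ?thesis
        using False norm_triangle_ineq4[of "\<phi> x" "(\<epsilon> / C) *\<^sub>R f x"] by linarith
    qed
    show "\<exists>x. N - \<epsilon>' < norm (\<phi> x) \<and> f x = 0" if \<epsilon>': "0 < \<epsilon>'" for \<epsilon>'
    proof -
      obtain x where "N - min \<epsilon> \<epsilon>' < norm (\<phi> x)"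
        using peak_nearly_attained[OF pk, of "min \<epsilon> \<epsilon>'"] \<epsilon> \<epsilon>' by auto
      then show ?thesis using zero[of x] by (intro exI[of _ x]) auto
    qed
  qed
qed

section \<open>Bounds on values of the image\<close>

text \<open>A small multiple of \<open>f\<close> is added to a peak pointing almost along
  \<open>T f y\<close>. The sum has norm at most \<open>N + s * R\<close>, while at \<open>y\<close>
  the norms of the images almost add up.\<close>

lemma norm_T_le_sup:
  assumes f: "f \<in> Lip" and R: "\<And>x. norm (f x) \<le> R"
  shows "norm (T f y) \<le> R"
proof (cases "T f y = 0")
  case True then show ?thesis using order_trans[OF norm_ge_zero R] by simp
next
  case False
  define w where "w = T f y"
  have w: "0 < norm w" using False by (simp add: w_def)
  obtain L where L: "0 < L" "f \<in> lip_ball L" using Lip_lip_ball[OF f] .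
  have R0: "0 \<le> R" by (rule order_trans[OF norm_ge_zero R])
  have main: "norm w * (1 - t) \<le> R" if t: "0 < t" "t \<le> 1 / 8" for t
  proof -
    define u where "u = (1 / norm w) *\<^sub>R w"
    have u: "norm u = 1" "w = norm w *\<^sub>R u" using w by (auto simp: u_def)
    obtain \<phi> N where pk: "peak y \<phi> N" and q: "norm (T \<phi> y - u) \<le> t"
      using exists_peak[OF u(1) t] by blast
    note \<phi> = peak_Lip[OF pk]
    have N1: "1 < N" and \<phi>N: "\<And>x. norm (\<phi> x) \<le> N"
      and \<phi>1: "\<And>x x'. norm (\<phi> x - \<phi> x') \<le> dist x x'" and Ty: "norm (T \<phi> y) = N"
      using pk lip_ball_norm by (auto simp: peak_def)
    \<comment> \<open>This choice uses up the whole gap: the perturbed function has slope at most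
      \<open>1 + s * L = N\<close>.\<close>
    define s where "s = (N - 1) / L"
    have s: "0 < s" "1 + s * L = N" using L N1 by (auto simp: s_def)
    have "(\<lambda>x. \<phi> x + s *\<^sub>R f x) \<in> lip_ball (N + s * R)"
    proof (rule lip_ballI)
      fix x x'
      show "norm (\<phi> x + s *\<^sub>R f x) \<le> N + s * R"
        using \<phi>N[of x] R[of x] s by (intro norm_triangle_mono) auto
      have "\<phi> x + s *\<^sub>R f x - (\<phi> x' + s *\<^sub>R f x') = (\<phi> x - \<phi> x') + s *\<^sub>R (f x - f x')"
        by (simp add: algebra_simps)
      also have "norm \<dots> \<le> dist x x' + s * (L * dist x x')"
        using \<phi>1[of x x'] lip_ball_diff[OF L(2), of x x'] s
        by (intro norm_triangle_mono) (auto intro!: mult_left_mono)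
      also have "\<dots> = (1 + s * L) * dist x x'" by (simp add: algebra_simps)
      also have "\<dots> \<le> (N + s * R) * dist x x'" using s R0 by (intro mult_right_mono) auto
      finally show "norm (\<phi> x + s *\<^sub>R f x - (\<phi> x' + s *\<^sub>R f x')) \<le> (N + s * R) * dist x x'" .
    qed
    then have "T (\<lambda>x. \<phi> x + s *\<^sub>R f x) \<in> lip_ball (N + s * R)" by (rule T_lip_ball)
    then have "norm (T \<phi> y + s *\<^sub>R w) \<le> N + s * R"
      using lip_ball_norm[of _ _ y] T_add[OF \<phi> Lip_scale[OF f]] T_scale[OF f]
      by (fastforce simp: w_def)
    \<comment> \<open>Replacing \<open>u\<close> by \<open>T \<phi> y\<close> makes the two summands
      parallel, at a cost of \<open>s * norm w * t\<close>.\<close>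
    moreover have "(1 + s * norm w) *\<^sub>R T \<phi> y =
        (T \<phi> y + s *\<^sub>R w) + (s * norm w) *\<^sub>R (T \<phi> y - u)"
      by (subst u(2)) (simp add: algebra_simps)
    moreover have "norm ((s * norm w) *\<^sub>R (T \<phi> y - u)) \<le> s * norm w * t"
      using q s by (simp add: mult_left_mono)
    ultimately have "norm ((1 + s * norm w) *\<^sub>R T \<phi> y) \<le> N + s * R + s * norm w * t"
      using norm_triangle_mono by metis
    moreover have "0 \<le> 1 + s * norm w" using s by simp
    ultimately have "(1 + s * norm w) * N \<le> N + s * R + s * norm w * t" using Ty by simp
    then have "s * (norm w * N) \<le> s * (R + norm w * t)" by (simp add: algebra_simps)
    then have "norm w * N \<le> R + norm w * t" using s by simp
    moreover have "norm w * 1 \<le> norm w * N" using N1 by (intro mult_left_mono) auto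
    ultimately show ?thesis by (simp add: algebra_simps)
  qed
  have "norm w \<le> R"
  proof (rule field_le_epsilon)
    fix \<eta> :: real assume \<eta>: "0 < \<eta>"
    define t where "t = min (1 / 8) (\<eta> / norm w)"
    have t: "0 < t" "t \<le> 1 / 8" "t \<le> \<eta> / norm w"
      unfolding t_def by (use \<eta> w in simp, rule min.cobounded1, rule min.cobounded2)
    then have "norm w * t \<le> \<eta>" using w by (simp add: field_simps)
    then show "norm w \<le> R + \<eta>" using main[OF t(1,2)] by (simp add: algebra_simps)
  qed
  then show ?thesis by (simp add: w_def)
qed

text \<open>Near maximizers of a single peak form a Cauchy sequence by concentration. Cutting
  \<open>f\<close> off around them changes nothing at \<open>y\<close> by \<open>peak_local\<close>,
  and \<open>norm_T_le_sup\<close> bounds what is left.\<close>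

lemma exists_upper_representing_sequence:
  "\<exists>x. Cauchy x \<and> (\<forall>f\<in>Lip. \<forall>\<eta>>0. \<forall>\<^sub>F n in sequentially. norm (T f y) \<le> norm (f (x n)) + \<eta>)"
proof -
  obtain v :: 'f where "norm v = 1" using exists_unit_F by blast
  then obtain \<phi> N where pk: "peak y \<phi> N" using exists_peak[of v "1 / 8" y] by auto
  have "\<exists>x. N - 1 / real (Suc n) < norm (\<phi> x)" for n
    by (rule peak_nearly_attained[OF pk]) simp
  then obtain x where x: "\<And>n. N - 1 / real (Suc n) < norm (\<phi> (x n))" by metis
  have tail: "\<forall>\<^sub>F n in sequentially. N - \<epsilon> < norm (\<phi> (x n))" if \<epsilon>: "0 < \<epsilon>" for \<epsilon>
  proof -
    obtain m where m: "1 / real (Suc m) < \<epsilon>" using nat_approx_posE[OF \<epsilon>] .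
    have "N - \<epsilon> < norm (\<phi> (x n))" if "m \<le> n" for n
    proof -
      have "1 / real (Suc n) \<le> 1 / real (Suc m)" using that by (intro divide_left_mono) auto
      then show ?thesis using x[of n] m by linarith
    qed
    then show ?thesis by (auto simp: eventually_sequentially)
  qed
  have "Cauchy x"
  proof (rule metric_CauchyI)
    fix \<delta> :: real assume \<delta>: "0 < \<delta>"
    obtain \<epsilon> a where \<epsilon>: "0 < \<epsilon>" and a: "\<And>x. N - \<epsilon> < norm (\<phi> x) \<Longrightarrow> dist x a \<le> 2 * (\<delta> / 8)"
      using peak_concentrated[OF pk, of "\<delta> / 8"] \<delta> by auto
    obtain M where M: "\<And>n. M \<le> n \<Longrightarrow> N - \<epsilon> < norm (\<phi> (x n))"
      using tail[OF \<epsilon>] by (auto simp: eventually_sequentially)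
    have "dist (x m) (x n) < \<delta>" if "M \<le> m" "M \<le> n" for m n
      using a[OF M[OF that(1)]] a[OF M[OF that(2)]] dist_triangle2[of "x m" "x n" a] \<delta> by linarith
    then show "\<exists>M. \<forall>m\<ge>M. \<forall>n\<ge>M. dist (x m) (x n) < \<delta>" by blast
  qed
  moreover have "\<forall>\<^sub>F n in sequentially. norm (T f y) \<le> norm (f (x n)) + \<eta>"
    if f: "f \<in> Lip" and \<eta>: "0 < \<eta>" for f \<eta>
  proof -
    obtain L where L: "0 < L" "f \<in> lip_ball L" using Lip_lip_ball[OF f] .
    \<comment> \<open>The cutoff lives within \<open>4 * \<rho>\<close> of \<open>a\<close> and
      \<open>x n\<close> within \<open>2 * \<rho>\<close>, so \<open>f\<close> varies by at most
      \<open>6 * \<rho> * L = \<eta>\<close>.\<close>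
    define \<rho> where "\<rho> = \<eta> / (6 * L)"
    have \<rho>: "0 < \<rho>" "6 * \<rho> * L = \<eta>" using L \<eta> by (auto simp: \<rho>_def)
    obtain \<epsilon> a where \<epsilon>: "0 < \<epsilon>" and a: "\<And>x. N - \<epsilon> < norm (\<phi> x) \<Longrightarrow> dist x a \<le> 2 * \<rho>"
      using peak_concentrated[OF pk \<rho>(1)] by auto
    have \<rho>2: "0 < 2 * \<rho>" using \<rho> by simp
    define b where "b = cutoff a (2 * \<rho>)"
    define g where "g = (\<lambda>x. b x *\<^sub>R f x)"
    have gL: "g \<in> Lip" unfolding g_def b_def
      by (rule Lip_mult[OF f cutoff_abs_le[OF \<rho>2] cutoff_lipschitz[OF \<rho>2]])
    have "T (\<lambda>x. f x - g x) y = 0"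
      by (rule peak_local[OF pk Lip_diff[OF f gL] \<epsilon>])
         (simp add: g_def b_def cutoff_props(3)[OF \<rho>2 a])
    then have Tg: "T g y = T f y" using T_diff[OF f gL] by simp
    have "norm (T f y) \<le> norm (f (x n)) + \<eta>" if n: "N - \<epsilon> < norm (\<phi> (x n))" for n
      unfolding Tg[symmetric]
    proof (rule norm_T_le_sup[OF gL])
      fix z
      show "norm (g z) \<le> norm (f (x n)) + \<eta>"
      proof (cases "dist z a < 4 * \<rho>")
        case True
        have "dist z (x n) \<le> 6 * \<rho>"
          using True a[OF n] dist_triangle2[of z "x n" a] by linarith
        then have "L * dist z (x n) \<le> \<eta>"
          using \<rho> L mult_left_mono[of "dist z (x n)" "6 * \<rho>" L] by (simp add: ac_simps)
        then have "norm (f z) \<le> norm (f (x n)) + \<eta>"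
          using lip_ball_diff[OF L(2), of z "x n"] norm_triangle_ineq2[of "f z" "f (x n)"] by linarith
        moreover have "norm (g z) \<le> norm (f z)"
          using cutoff_props(1,2)[OF \<rho>2, of a z] by (simp add: g_def b_def mult_left_le_one_le)
        ultimately show ?thesis by simp
      next
        case False
        then have "g z = 0" using cutoff_props(4)[OF \<rho>2, of z a] by (simp add: g_def b_def)
        then show ?thesis using \<eta> by simp
      qed
    qed
    then show ?thesis using tail[OF \<epsilon>] by (auto elim: eventually_mono)
  qed
  ultimately show ?thesis by blast
qed

section \<open>Representation by Cauchy sequences\<close>

lemma T_zero: "T (\<lambda>_. 0) = (\<lambda>_. 0)"
  using T_scale[OF Lip_const, of 0 0] by simp

lemma S_zero: "S (\<lambda>_. 0) = (\<lambda>_. 0)"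
  using S_T[OF Lip_const, of 0] T_zero by simp

text \<open>Otherwise \<open>f\<close>, the preimage of a unit constant, vanishes at
  \<open>x\<close>. A tent of radius \<open>1 / 2\<close> at \<open>x\<close> has nonzero image at
  some \<open>y\<close>, so the sequence for \<open>y\<close> enters that ball, where
  \<open>f\<close> has norm below \<open>1 / 2\<close>; but \<open>T f y\<close> has norm 1.\<close>

lemma inverse_property_P: "\<exists>v. S (\<lambda>_. v) x \<noteq> 0"
proof (rule ccontr)
  assume "\<not> ?thesis"
  then have zero: "S (\<lambda>_. v) x = 0" for v by blast
  obtain v :: 'f where v: "norm v = 1" using exists_unit_F by blast
  obtain e :: 'e where e: "norm e = 1" using exists_unit_E by blast
  define f where "f = S (\<lambda>_. v)"
  have f: "f \<in> Lip" "f x = 0" "f \<in> lip_ball 1" "T f = (\<lambda>_. v)"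
    using zero S_Lip[OF Lip_const] S_ball[OF Lip_const] T_S[OF Lip_const] v
    by (auto simp: f_def intro: lip_ball_const)
  define g where "g = (\<lambda>z. tent x (1 / 2) z *\<^sub>R e)"
  have g: "g \<in> Lip" unfolding g_def by (rule tent_Lip) simp
  have "g x \<noteq> 0" using e by (auto simp: g_def tent_def)
  then have "T g \<noteq> (\<lambda>_. 0)" using S_T[OF g] S_zero by auto
  then obtain y where y: "T g y \<noteq> 0" by auto
  obtain s where s: "\<And>f \<eta>. f \<in> Lip \<Longrightarrow> 0 < \<eta> \<Longrightarrow> \<forall>\<^sub>F n in sequentially. norm (T f y) \<le> norm (f (s n)) + \<eta>"
    using exists_upper_representing_sequence[of y] by blast
  have "\<forall>\<^sub>F n in sequentially. norm (T g y) \<le> norm (g (s n)) + norm (T g y) / 2 \<and>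
      norm (T f y) \<le> norm (f (s n)) + 1 / 4"
    using y by (intro eventually_conj s g f) auto
  then obtain n where n: "norm (T g y) \<le> norm (g (s n)) + norm (T g y) / 2"
      "norm (T f y) \<le> norm (f (s n)) + 1 / 4"
    using eventually_happens'[OF sequentially_bot] by blast
  have "g (s n) \<noteq> 0" using n(1) y by auto
  then have "dist (s n) x < 1 / 2" by (auto simp: g_def tent_def max_def split: if_splits)
  moreover have "norm (f (s n)) \<le> dist (s n) x"
    using lip_ball_diff[OF f(3), of "s n" x] f(2) by simp
  ultimately show False using n(2) v f(4) by simp
qed

text \<open>Supplies the upper bounds for \<open>S\<close> that become lower bounds for
  \<open>T\<close>.\<close>

lemma swap: "lip_isometry S T"
  by unfold_locales
    (fact convex_E convex_F S_Lip T_Lip T_S S_T S_add S_scale S_ball inverse_property_P)+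

text \<open>The sequence stands for a point of the completion of the domain.\<close>

definition represents :: "(nat \<Rightarrow> 'x) \<Rightarrow> 'y \<Rightarrow> bool" where
  "represents x y \<longleftrightarrow> Cauchy x \<and> (\<forall>f\<in>Lip. (\<lambda>n. norm (f (x n))) \<longlonglongrightarrow> norm (T f y))"

text \<open>For the lower bound, \<open>g\<close> is a small tent at \<open>y\<close>. Its preimage
  \<open>S g\<close> is nonzero at \<open>x n\<close> for large \<open>n\<close>, so the sequence
  that \<open>S\<close> attaches to \<open>x n\<close> enters the tent. The upper bound for
  \<open>S\<close> then compares \<open>f (x n)\<close> with a value of \<open>T f\<close> near
  \<open>y\<close>.\<close>

lemma exists_representing: "\<exists>x. represents x y"
proof -
  interpret inv: lip_isometry S T by (rule swap)
  obtain x where x: "Cauchy x"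
    and up: "\<And>f \<eta>. f \<in> Lip \<Longrightarrow> 0 < \<eta> \<Longrightarrow> \<forall>\<^sub>F n in sequentially. norm (T f y) \<le> norm (f (x n)) + \<eta>"
    using exists_upper_representing_sequence[of y] by blast
  obtain v :: 'f where v: "norm v = 1" using exists_unit_F by blast
  have low: "\<forall>\<^sub>F n in sequentially. norm (f (x n)) \<le> norm (T f y) + \<eta>"
    if f: "f \<in> Lip" and \<eta>: "0 < \<eta>" for f \<eta>
  proof -
    obtain L where L: "0 < L" "T f \<in> lip_ball L" using Lip_lip_ball[OF T_Lip[OF f]] .
    define \<delta> where "\<delta> = \<eta> / (2 * L)"
    have \<delta>: "0 < \<delta>" "L * \<delta> = \<eta> / 2" using \<eta> L by (auto simp: \<delta>_def)
    define g where "g = (\<lambda>z. tent y \<delta> z *\<^sub>R v)"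
    have g: "g \<in> Lip" unfolding g_def by (rule tent_Lip[OF \<delta>(1)])
    have gy: "norm (T (S g) y) = \<delta>" unfolding T_S[OF g] using \<delta> v by (simp add: g_def tent_def)
    have "norm (f (x n)) \<le> norm (T f y) + \<eta>"
      if n: "norm (T (S g) y) \<le> norm (S g (x n)) + \<delta> / 2" for n
    proof -
      define c where "c = norm (S g (x n))"
      have c: "0 < c" using n \<delta> unfolding gy c_def by linarith
      obtain z where z: "\<And>g \<eta>. g \<in> Lip \<Longrightarrow> 0 < \<eta> \<Longrightarrow>
          \<forall>\<^sub>F m in sequentially. norm (S g (x n)) \<le> norm (g (z m)) + \<eta>"
        using inv.exists_upper_representing_sequence[of "x n"] by blast
      have "\<forall>\<^sub>F m in sequentially. norm (S g (x n)) \<le> norm (g (z m)) + c / 2 \<and>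
          norm (S (T f) (x n)) \<le> norm (T f (z m)) + \<eta> / 2"
        using c \<eta> by (intro eventually_conj z g T_Lip f) auto
      then obtain m where m: "c \<le> norm (g (z m)) + c / 2"
          "norm (f (x n)) \<le> norm (T f (z m)) + \<eta> / 2"
        using eventually_happens'[OF sequentially_bot] unfolding S_T[OF f] c_def by blast
      have "g (z m) \<noteq> 0" using m(1) c by auto
      then have "dist (z m) y < \<delta>" by (auto simp: g_def tent_def max_def split: if_splits)
      then have "L * dist (z m) y \<le> \<eta> / 2"
        using L \<delta> mult_left_mono[of "dist (z m) y" \<delta> L] by linarith
      then have "norm (T f (z m)) \<le> norm (T f y) + \<eta> / 2"
        using lip_ball_diff[OF L(2), of "z m" y] norm_triangle_ineq2[of "T f (z m)" "T f y"] by linarith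
      then show ?thesis using m(2) by simp
    qed
    then show ?thesis
      using up[OF S_Lip[OF g], of "\<delta> / 2"] \<delta> by (auto elim: eventually_mono)
  qed
  have "(\<lambda>n. norm (f (x n))) \<longlonglongrightarrow> norm (T f y)" if f: "f \<in> Lip" for f
  proof (rule tendstoI)
    fix \<epsilon> :: real assume \<epsilon>: "0 < \<epsilon>"
    have "\<forall>\<^sub>F n in sequentially. norm (T f y) \<le> norm (f (x n)) + \<epsilon> / 2 \<and>
        norm (f (x n)) \<le> norm (T f y) + \<epsilon> / 2"
      using \<epsilon> by (intro eventually_conj up low f) auto
    then show "\<forall>\<^sub>F n in sequentially. dist (norm (f (x n))) (norm (T f y)) < \<epsilon>"
      by eventually_elim (use \<epsilon> in \<open>auto simp: dist_real_def abs_less_iff\<close>)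
  qed
  then show ?thesis using x unfolding represents_def by blast
qed

lemma represents_norm:
  "represents x y \<Longrightarrow> f \<in> Lip \<Longrightarrow> (\<lambda>n. norm (f (x n))) \<longlonglongrightarrow> norm (T f y)"
  unfolding represents_def by blast

section \<open>The action on constants and completeness\<close>

lemma norm_T_const: "norm (T (\<lambda>_. e) y) = norm e"
proof -
  obtain x where "represents x y" using exists_representing by blast
  from represents_norm[OF this Lip_const[of e]] show ?thesis by (simp add: LIMSEQ_const_iff)
qed

lemma T_const_diff: "T (\<lambda>_. a - b) y = T (\<lambda>_. a) y - T (\<lambda>_. b) y"
  using T_diff[OF Lip_const Lip_const, of a b] by simp

lemma norm_T_const_diff: "norm (T (\<lambda>_. a) y - T (\<lambda>_. b) y) = norm (a - b)"
  using norm_T_const[of "a - b" y] by (simp add: T_const_diff)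

text \<open>The values \<open>f (x n)\<close> may have no limit in the range space. Applying the
  norm formula to \<open>f\<close> minus the constant \<open>f (x m)\<close> turns their Cauchy
  property into convergence of the images.\<close>

lemma represents_tendsto:
  assumes x: "represents x y" and f: "f \<in> Lip"
  shows "(\<lambda>n. T (\<lambda>_. f (x n)) y) \<longlonglongrightarrow> T f y"
proof (rule LIMSEQ_I)
  fix e :: real assume e: "0 < e"
  have "Cauchy (\<lambda>n. f (x n))" using x by (intro Lip_Cauchy[OF f]) (simp add: represents_def)
  from CauchyD[OF this, of "e / 2"] e
  obtain M where M: "\<And>m n. M \<le> m \<Longrightarrow> M \<le> n \<Longrightarrow> norm (f (x m) - f (x n)) < e / 2"
    by auto
  have "norm (T (\<lambda>_. f (x m)) y - T f y) < e" if m: "M \<le> m" for m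
  proof -
    have "(\<lambda>n. norm (f (x n) - f (x m))) \<longlonglongrightarrow> norm (T (\<lambda>z. f z - f (x m)) y)"
      by (rule represents_norm[OF x Lip_diff[OF f Lip_const]])
    then have "norm (T (\<lambda>z. f z - f (x m)) y) \<le> e / 2"
      by (rule LIMSEQ_le_const2) (use M m less_imp_le in blast)
    then show ?thesis using e T_diff[OF f Lip_const, of "f (x m)"] by (simp add: norm_minus_commute)
  qed
  then show "\<exists>M. \<forall>m\<ge>M. norm (T (\<lambda>_. f (x m)) y - T f y) < e" by blast
qed

lemma represents_limit:
  assumes x: "represents x y" and f: "f \<in> Lip" and e: "(\<lambda>n. f (x n)) \<longlonglongrightarrow> e"
  shows "T f y = T (\<lambda>_. e) y"
proof -
  have "(\<lambda>n. norm (f (x n) - e)) \<longlonglongrightarrow> 0" using e by (simp add: LIM_zero tendsto_norm_zero)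
  then have "(\<lambda>n. norm (T (\<lambda>_. f (x n)) y - T (\<lambda>_. e) y)) \<longlonglongrightarrow> 0" by (simp add: norm_T_const_diff)
  then have "(\<lambda>n. T (\<lambda>_. f (x n)) y) \<longlonglongrightarrow> T (\<lambda>_. e) y"
    by (rule LIM_zero_cancel[OF tendsto_norm_zero_cancel])
  then show ?thesis using represents_tendsto[OF x f] LIMSEQ_unique by blast
qed

lemma represents_limit_point:
  assumes x: "represents x y" and z: "x \<longlonglongrightarrow> z" and f: "f \<in> Lip"
  shows "T f y = T (\<lambda>_. f z) y"
proof (rule represents_limit[OF x f])
  obtain L where L: "0 < L" "f \<in> lip_ball L" using Lip_lip_ball[OF f] .
  have "(\<lambda>n. L * dist (x n) z) \<longlonglongrightarrow> 0"
    using tendsto_mult_right_zero[of "\<lambda>n. dist (x n) z" _ L] z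
      tendsto_dist_iff[of x z] by blast
  then have "(\<lambda>n. f (x n) - f z) \<longlonglongrightarrow> 0"
    by (rule Lim_null_comparison[rotated]) (simp add: lip_ball_diff[OF L(2)])
  then show "(\<lambda>n. f (x n)) \<longlonglongrightarrow> f z" by (rule LIM_zero_cancel)
qed

lemma T_const_surjI:
  assumes "\<And>f. f \<in> Lip \<Longrightarrow> \<exists>e. T f y = T (\<lambda>_. e) y"
  shows "\<exists>e. T (\<lambda>_. e) y = v"
  using assms[OF S_Lip[OF Lip_const, of v]] T_S[OF Lip_const, of v] by metis

lemma T_const_surj_of_complete:
  assumes "complete (UNIV :: 'e set)"
  shows "\<exists>e. T (\<lambda>_. e) y = v"
proof (rule T_const_surjI)
  fix f :: "'x \<Rightarrow> 'e" assume f: "f \<in> Lip"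
  obtain x where x: "represents x y" using exists_representing by blast
  then have "Cauchy (\<lambda>n. f (x n))" by (intro Lip_Cauchy[OF f]) (simp add: represents_def)
  then obtain e where "(\<lambda>n. f (x n)) \<longlonglongrightarrow> e" using assms unfolding complete_def by blast
  then show "\<exists>e. T f y = T (\<lambda>_. e) y" using represents_limit[OF x f] by blast
qed

text \<open>At any fixed point, \<open>T\<close> on constants is a distance-preserving
  surjection.\<close>

lemma complete_F_of_complete_E:
  assumes "complete (UNIV :: 'e set)"
  shows "complete (UNIV :: 'f set)"
  unfolding complete_def
proof (intro allI impI)
  fix v :: "nat \<Rightarrow> 'f" assume v: "(\<forall>n. v n \<in> UNIV) \<and> Cauchy v"
  define y :: 'y where "y = undefined"
  have "\<exists>e. T (\<lambda>_. e) y = v n" for n by (rule T_const_surj_of_complete[OF assms])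
  then obtain u where u: "\<And>n. T (\<lambda>_. u n) y = v n" by metis
  have "dist (u m) (u n) = dist (v m) (v n)" for m n
    using norm_T_const_diff[of "u m" y "u n"] by (simp add: u dist_norm)
  then have "Cauchy u" using v by (simp add: Cauchy_def)
  then obtain e where e: "u \<longlonglongrightarrow> e" using assms unfolding complete_def by blast
  have "dist (v n) (T (\<lambda>_. e) y) = dist (u n) e" for n
    using norm_T_const_diff[of "u n" y e] by (simp add: u dist_norm)
  then have "v \<longlonglongrightarrow> T (\<lambda>_. e) y" using e by (simp add: tendsto_dist_iff[of v] tendsto_dist_iff[of u])
  then show "\<exists>l\<in>UNIV. v \<longlonglongrightarrow> l" by blast
qed

lemma complete_iff: "complete (UNIV :: 'e set) \<longleftrightarrow> complete (UNIV :: 'f set)"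
proof -
  interpret inv: lip_isometry S T by (rule swap)
  show ?thesis using complete_F_of_complete_E inv.complete_F_of_complete_E by blast
qed

text \<open>A Cauchy sequence \<open>v\<close> is approximated by images of constants
  \<open>u k\<close>; a Lipschitz function \<open>f\<close> asymptotic to \<open>u\<close> along
  \<open>x\<close> then has \<open>T f y\<close> as the limit of \<open>v\<close>.\<close>

lemma complete_F_of_divergent:
  assumes x: "represents x y" and div: "\<not> convergent x"
  shows "complete (UNIV :: 'f set)"
  unfolding complete_def
proof (intro allI impI)
  fix v :: "nat \<Rightarrow> 'f" assume "(\<forall>n. v n \<in> UNIV) \<and> Cauchy v"
  then have v: "Cauchy v" by blast
  have "\<exists>e. norm (T (\<lambda>_. e) y - v k) < 1 / real (Suc k)" for k
  proof -
    \<comment> \<open>Images of constants are dense: the values of the preimage of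
      \<open>v k\<close> along \<open>x\<close> serve as constants.\<close>
    have "(\<lambda>n. T (\<lambda>_. S (\<lambda>_. v k) (x n)) y) \<longlonglongrightarrow> v k"
      using represents_tendsto[OF x S_Lip[OF Lip_const, of "v k"]] T_S[OF Lip_const, of "v k"] by simp
    from LIMSEQ_D[OF this, of "1 / real (Suc k)"] show ?thesis by auto
  qed
  then obtain u where u: "\<And>k. norm (T (\<lambda>_. u k) y - v k) < 1 / real (Suc k)" by metis
  have Ju: "(\<lambda>k. T (\<lambda>_. u k) y - v k) \<longlonglongrightarrow> 0"
    by (rule Lim_null_comparison[OF _ LIMSEQ_Suc[OF lim_1_over_n]])
       (use u in \<open>auto intro!: always_eventually less_imp_le\<close>)
  have "Cauchy u"
  proof (rule metric_CauchyI)
    fix e :: real assume "0 < e"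
    then have e: "0 < e / 3" by simp
    obtain M where M: "\<And>k. M \<le> k \<Longrightarrow> norm (T (\<lambda>_. u k) y - v k) < e / 3"
      using LIMSEQ_D[OF Ju e] by auto
    obtain M' where M': "\<And>m n. M' \<le> m \<Longrightarrow> M' \<le> n \<Longrightarrow> norm (v m - v n) < e / 3"
      using CauchyD[OF v e] by blast
    have "dist (u m) (u n) < e" if "max M M' \<le> m" "max M M' \<le> n" for m n
    proof -
      have "dist (u m) (u n) = norm ((T (\<lambda>_. u m) y - v m) + (v m - v n) - (T (\<lambda>_. u n) y - v n))"
        using norm_T_const_diff[of "u m" y "u n"] by (simp add: dist_norm)
      also have "\<dots> \<le> norm (T (\<lambda>_. u m) y - v m) + norm (v m - v n) + norm (T (\<lambda>_. u n) y - v n)"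
        by (rule order_trans[OF norm_triangle_ineq4 add_right_mono[OF norm_triangle_ineq]])
      also have "\<dots> < e" using M[of m] M[of n] M'[of m n] that by simp
      finally show ?thesis .
    qed
    then show "\<exists>M. \<forall>m\<ge>M. \<forall>n\<ge>M. dist (u m) (u n) < e" by blast
  qed
  then obtain f where f: "f \<in> Lip" and fu: "(\<lambda>n. f (x n) - u n) \<longlonglongrightarrow> 0"
    using Lip_along_divergent_Cauchy[OF _ div] x unfolding represents_def by blast
  have "(\<lambda>n. T (\<lambda>_. f (x n)) y - T (\<lambda>_. u n) y) \<longlonglongrightarrow> 0"
    by (rule tendsto_norm_zero_cancel) (simp add: norm_T_const_diff tendsto_norm_zero[OF fu])
  from tendsto_diff[OF tendsto_diff[OF represents_tendsto[OF x f] this] Ju]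
  have "v \<longlonglongrightarrow> T f y" by simp
  then show "\<exists>l\<in>UNIV. v \<longlonglongrightarrow> l" by blast
qed

text \<open>Divergence of the representing sequence would make the domain incomplete and both range
  spaces complete.\<close>

lemma exists_point_representing:
  assumes "complete (UNIV :: 'x set) \<or> \<not> complete (UNIV :: 'e set)"
  shows "\<exists>z. \<forall>f\<in>Lip. T f y = T (\<lambda>_. f z) y"
proof -
  obtain x where x: "represents x y" using exists_representing by blast
  have "convergent x"
  proof (cases "complete (UNIV :: 'x set)")
    case True
    then show ?thesis using x by (auto simp: represents_def complete_def convergent_def)
  next
    case False
    then show ?thesis using assms complete_F_of_divergent[OF x] complete_iff by blast
  qed
  then show ?thesis using represents_limit_point[OF x] by (auto simp: convergent_def)
qed

text \<open>Completeness provides limits of the values \<open>f (x n)\<close>; its failure provides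
  limits of \<open>x\<close> itself.\<close>

lemma T_const_surj: "\<exists>e. T (\<lambda>_. e) y = v"
proof (cases "complete (UNIV :: 'e set)")
  case True
  then show ?thesis by (rule T_const_surj_of_complete)
next
  case False
  then show ?thesis using exists_point_representing[of y] by (intro T_const_surjI) blast
qed

section \<open>Comparison of distances\<close>

text \<open>Choose \<open>w\<close> whose image at \<open>y'\<close> is opposite to that of
  \<open>e\<close> at \<open>y\<close>. The function of least norm \<open>C\<close> with values
  \<open>e\<close> and \<open>w\<close> has image values 2 apart, so
  \<open>2 \<le> C * dist y y'\<close>. As \<open>dist y y' < 2\<close>, \<open>C\<close> is the
  slope, at most \<open>2 / dist x x'\<close>. If the distances agree, \<open>e - w\<close> has norm
  2 and strict convexity gives \<open>w = - e\<close>.\<close>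

lemma two_point:
  assumes yx: "\<And>f. f \<in> Lip \<Longrightarrow> T f y = T (\<lambda>_. f x) y"
    and yx': "\<And>f. f \<in> Lip \<Longrightarrow> T f y' = T (\<lambda>_. f x') y'"
    and ne: "x \<noteq> x'" "y \<noteq> y'" and lt: "dist y y' < 2" and e: "norm e = 1"
  shows "dist x x' \<le> dist y y'"
    and "dist x x' = dist y y' \<Longrightarrow> T (\<lambda>_. e) y = T (\<lambda>_. e) y'"
proof -
  define D where "D = dist x x'"
  have D: "0 < D" using ne by (simp add: D_def)
  obtain w where w: "T (\<lambda>_. w) y' = - T (\<lambda>_. e) y" using T_const_surj by blast
  have nw: "norm w = 1" using norm_T_const[of w y'] norm_T_const[of e y] e w by simp
  define C where "C = max 1 (norm (e - w) / D)"
  obtain f where f: "f \<in> lip_ball C" "f x = e" "f x' = w"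
    using segment_extension[OF ne(1), of e w] e nw unfolding C_def D_def by auto
  have TfC: "T f \<in> lip_ball C" by (rule T_lip_ball[OF f(1)])
  have "T f y - T f y' = 2 *\<^sub>R T (\<lambda>_. e) y"
    using yx[of f] yx'[of f] lip_ball_Lip[OF f(1)] f w by (simp add: scaleR_2)
  then have 2: "2 \<le> C * dist y y'"
    using lip_ball_diff[OF TfC, of y y'] norm_T_const[of e y] e by simp
  have C: "C = norm (e - w) / D"
  proof (rule ccontr)
    assume "C \<noteq> norm (e - w) / D"
    then have "C = 1" by (simp add: C_def max_def split: if_splits)
    then show False using 2 lt by simp
  qed
  have ew: "2 * D \<le> norm (e - w) * dist y y'" using 2 D unfolding C by (simp add: field_simps)
  have "norm (e - w) \<le> 2" using norm_triangle_ineq4[of e w] e nw by simp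
  then have "norm (e - w) * dist y y' \<le> 2 * dist y y'" by (intro mult_right_mono) auto
  then show "dist x x' \<le> dist y y'" using ew unfolding D_def by linarith
  assume "dist x x' = dist y y'"
  then have "2 \<le> norm (e + (- w))" using ew D by (simp add: D_def)
  then have "e = - w" using e nw by (intro strictly_convex_eq[OF convex_E, of _ 1]) auto
  then have "T (\<lambda>_. e) y' = - T (\<lambda>_. w) y'" using T_const_scale[of "-1" w y'] by simp
  then show "T (\<lambda>_. e) y = T (\<lambda>_. e) y'" using w by simp
qed

text \<open>Passing through \<open>T\<close> and \<open>S\<close> shows that \<open>f\<close> has
  the same norm at \<open>x\<close> and at \<open>h (k x)\<close>; a tent at \<open>x\<close> tells
  distinct points apart.\<close>

lemma weighted_composition_inverse:
  assumes h: "\<And>f y. f \<in> Lip \<Longrightarrow> T f y = T (\<lambda>_. f (h y)) y"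
    and k: "\<And>g x. g \<in> Lip \<Longrightarrow> S g x = S (\<lambda>_. g (k x)) x"
  shows "h (k x) = x"
proof (rule ccontr)
  interpret inv: lip_isometry S T by (rule swap)
  assume ne: "h (k x) \<noteq> x"
  define d where "d = dist x (h (k x))"
  have d: "0 < d" using ne by (simp add: d_def)
  obtain e :: 'e where e: "norm e = 1" using exists_unit_E by blast
  define f where "f = (\<lambda>z. tent x d z *\<^sub>R e)"
  have f: "f \<in> Lip" unfolding f_def by (rule tent_Lip[OF d])
  have "norm (f x) = norm (T f (k x))"
    using k[OF T_Lip[OF f], of x] inv.norm_T_const[of "T f (k x)" x] S_T[OF f] by simp
  also have "\<dots> = norm (f (h (k x)))" using h[OF f, of "k x"] norm_T_const by simp
  also have "\<dots> = 0" by (simp add: f_def tent_def d_def dist_commute)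
  finally show False using d e by (simp add: f_def tent_def)
qed

end

section \<open>The isometry of the range spaces and the standard form\<close>

theorem theorem3p1:
  fixes K :: "complex set"
    and scE :: "complex \<Rightarrow> 'e::real_normed_vector \<Rightarrow> 'e"
    and scF :: "complex \<Rightarrow> 'f::real_normed_vector \<Rightarrow> 'f"
    and T :: "('x::metric_space \<Rightarrow> 'e) \<Rightarrow> ('y::metric_space \<Rightarrow> 'f)"
  assumes K: "scalar_field K"
    and E: "normed_space_over K scE" and F: "normed_space_over K scF"
    and scE: "strictly_convex TYPE('e)" and scF: "strictly_convex TYPE('f)"
    and T_into: "\<forall>f\<in>Lip. T f \<in> Lip"
    and T_onto: "T ` Lip = Lip"
    and T_add: "\<forall>f\<in>Lip. \<forall>g\<in>Lip. T (\<lambda>x. f x + g x) = (\<lambda>y. T f y + T g y)"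
    and T_scal: "\<forall>c\<in>K. \<forall>f\<in>Lip. T (\<lambda>x. scE c (f x)) = (\<lambda>y. scF c (T f y))"
    and T_iso: "\<forall>f\<in>Lip. lip_norm (T f) = lip_norm f"
    and P: "property_P T"
  shows "lin_isos K scE scF \<noteq> {} \<and>
         ((complete (UNIV::'x set) \<and> complete (UNIV::'y set)) \<or>
            \<not> complete (UNIV::'e set) \<or> \<not> complete (UNIV::'f set)
          \<longrightarrow> standard K scE scF T)"
proof -
  have real_K: "complex_of_real r \<in> K" for r
    using K by (auto simp: scalar_field_def)
  have scale: "T (\<lambda>x. c *\<^sub>R f x) = (\<lambda>y. c *\<^sub>R T f y)" if "f \<in> Lip" for c f
    using T_scal real_K[of c] that E F unfolding normed_space_over_def by fastforce
  have ball: "T f \<in> lip_ball C \<longleftrightarrow> f \<in> lip_ball C" if "f \<in> Lip" for f C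
    using lip_norm_le_iff[of f C] lip_norm_le_iff[of "T f" C] T_into T_iso that by simp
  have "inj_on T Lip"
  proof (rule inj_onI)
    fix f g assume fg: "f \<in> Lip" "g \<in> Lip" "T f = T g"
    have "T (\<lambda>x. f x + (-1) *\<^sub>R g x) = (\<lambda>y. T f y + (-1) *\<^sub>R T g y)"
      using bspec[OF bspec[OF T_add fg(1)] Lip_scale[OF fg(2), of "-1"]] scale[OF fg(2), of "-1"]
      by simp
    \<comment> \<open>The ball of radius 0 contains only the zero function, so preserving it amounts
      to injectivity.\<close>
    then have "T (\<lambda>x. f x - g x) \<in> lip_ball 0" using fg by (simp add: lip_ball_def)
    then have "(\<lambda>x. f x - g x) \<in> lip_ball 0" using ball Lip_diff fg by blast
    then show "f = g" by (auto simp: lip_ball_def)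
  qed
  define S where "S = inv_into Lip T"
  have S: "g \<in> Lip \<Longrightarrow> S g \<in> Lip" "g \<in> Lip \<Longrightarrow> T (S g) = g" "f \<in> Lip \<Longrightarrow> S (T f) = f" for f g
    using inv_into_into[of g T Lip] f_inv_into_f[of g T Lip] inv_into_f_f[OF \<open>inj_on T Lip\<close>] T_onto
    by (auto simp: S_def)
  interpret lip_isometry T S
    by unfold_locales (use scE scF T_into T_add P S scale ball in \<open>simp_all add: property_P_def\<close>)
  interpret inv: lip_isometry S T by (rule swap)
  define J where "J = (\<lambda>y e. T (\<lambda>_. e) y)"
  have J: "J y \<in> lin_isos K scE scF" for y
    unfolding lin_isos_def K_linear_def
  proof (intro CollectI conjI allI ballI)
    show "surj (J y)" using T_const_surj[of y] by (metis J_def surjI)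
    show "J y (a + b) = J y a + J y b" for a b
      using T_add[OF Lip_const[of a] Lip_const[of b]] by (simp add: J_def)
    show "J y (scE c a) = scF c (J y a)" if "c \<in> K" for c a
      using bspec[OF bspec[OF T_scal that] Lip_const[of a]] by (simp add: J_def)
    show "norm (J y a) = norm a" for a by (simp add: J_def norm_T_const)
  qed
  have "standard K scE scF T"
    if c: "complete (UNIV::'x set) \<and> complete (UNIV::'y set) \<or>
            \<not> complete (UNIV::'e set) \<or> \<not> complete (UNIV::'f set)"
  proof -
    \<comment> \<open>By \<open>complete_iff\<close> incompleteness of either range space gives that
      of the other, so each alternative serves both \<open>T\<close> and \<open>S\<close>.\<close>
    obtain h where h: "\<And>f y. f \<in> Lip \<Longrightarrow> T f y = T (\<lambda>_. f (h y)) y"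
      using exists_point_representing complete_iff c by metis
    obtain k where k: "\<And>g x. g \<in> Lip \<Longrightarrow> S g x = S (\<lambda>_. g (k x)) x"
      using inv.exists_point_representing complete_iff c by metis
    have hk: "h (k x) = x" and kh: "k (h y) = y" for x y
      using weighted_composition_inverse[OF h k] inv.weighted_composition_inverse[OF k h] by auto
    have bij: "bij h" by (rule o_bij[of k]) (auto simp: fun_eq_iff hk kh)
    have inv_h: "inv h = k" by (rule inv_equality) (auto simp: hk kh)
    obtain e0 :: 'e where e0: "norm e0 = 1" using exists_unit_E by blast
    obtain v0 :: 'f where v0: "norm v0 = 1" using exists_unit_F by blast
    have h_le: "dist (h y) (h y') \<le> dist y y'" if "dist y y' < 2" for y y'
    proof (cases "y = y'")
      case False
      moreover have "h y \<noteq> h y'" using False kh by metis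
      ultimately show ?thesis using two_point(1)[OF h h _ _ that e0] by blast
    qed simp
    have k_le: "dist (k x) (k x') \<le> dist x x'" if "dist x x' < 2" for x x'
    proof (cases "x = x'")
      case False
      moreover have "k x \<noteq> k x'" using False hk by metis
      ultimately show ?thesis using inv.two_point(1)[OF k k _ _ that v0] by blast
    qed simp
    have h_eq: "dist (h y) (h y') = dist y y'" if "dist y y' < 2" for y y'
      \<comment> \<open>The images are again closer than 2, so the bound for the inverse applies to
        them and gives equality.\<close>
      using h_le[OF that] k_le[of "h y" "h y'"] that by (simp add: kh)
    have k_eq: "dist (k x) (k x') = dist x x'" if "dist x x' < 2" for x x'
      using k_le[OF that] h_le[of "k x" "k x'"] that by (simp add: hk)
    have J_near: "J y = J y'" if y: "dist y y' < 2" for y y'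
    proof (cases "y = y'")
      case False
      have hne: "h y \<noteq> h y'" using False kh by metis
      \<comment> \<open>Since \<open>h\<close> preserves this distance, the equality case of
        \<open>two_point\<close> applies to unit vectors; homogeneity does the rest.\<close>
      have unit: "J y e = J y' e" if "norm e = 1" for e
        unfolding J_def using two_point(2)[OF h h hne False y that] h_eq[OF y] by blast
      have J_scale: "J z (r *\<^sub>R e) = r *\<^sub>R J z e" for z r e by (simp add: J_def T_const_scale)
      show ?thesis
      proof
        fix e
        show "J y e = J y' e"
        proof (cases "e = 0")
          case True
          then show ?thesis by (simp add: J_def T_zero)
        next
          case False
          then have "e = norm e *\<^sub>R ((1 / norm e) *\<^sub>R e)" "norm ((1 / norm e) *\<^sub>R e) = 1" by auto
          then show ?thesis using unit J_scale by metis
        qed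
      qed
    qed simp
    have "J y = J y'" if "R_related 2 y y'" for y y'
      using that unfolding R_related_def by induction (simp, metis J_near)
    then show ?thesis
      unfolding standard_def Iso2_def
      using J bij h_eq k_eq inv_h h by (intro exI[of _ h] exI[of _ J]) (auto simp: J_def)
  qed
  moreover have "lin_isos K scE scF \<noteq> {}" using J by blast
  ultimately show ?thesis by blast
qed

end
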